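(* Let $\alpha$ be a closed, regular, smooth plane curve of length $l$, parametrized by arc length $s\in\mathbb{S}^1=\mathbb{R}/l\mathbb{Z}$, with curvature $k(s)>0$ for all $s$, and with rotation index $r^\alpha$. Then the normal map $F(s,\rho)=\alpha(s)+\rho\,n(s)$ associated with $\alpha$, regarded as a vector field on the cylinder and projected onto the sphere, has Poincaré indices at the north pole $N$ and the south pole $S$ given by $$i_N=1+r^\alpha,\qquad i_S=1-r^\alpha.$$
   Context: The unit tangent is $t=\dot\alpha$ and $n$ is the unit normal such that $(t,n)$ is right-handed; the curvature $k$ is defined by $\dot t=k n$ (equivalently $\dot n=-kt$). The curve may have self-intersections. The rotation index $r^\alpha$ is the degree of the map $\dot\alpha/|\dot\alpha|:\mathbb{S}^1\to\mathbb{S}^1$. The normal map $F:\mathbb{S}^1\times\mathbb{R}\to\mathbb{R}^2$, $F(s,\rho)=\alpha(s)+\rho\,n(s)$, is regarded as a vector field on the cylinder $\mathbb{S}^1\times\mathbb{R}$ by taking the two Cartesian components of $F=(F_1,F_2)$ as the components along the coordinate directions $\hat s,\hat\rho$, i.e. the vector field $F_1\partial_s+F_2\partial_\rho$. Projection to the sphere: the cylinder is placed in $\mathbb{R}^3$ as a right circular cylinder (circumference $l$, with $\rho$ the coordinate along the axis) so that $\hat s\times\hat\rho$ is outward pointing. Consider the sphere with centre $O$ on the axis at height $\rho=0$ that is tangent to the cylinder along $\rho=0$. A point $Q$ of the cylinder is mapped to the point $Q'$ where the line segment $QO$ meets the sphere. This is a diffeomorphism from the cylinder to the sphere minus its two poles;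 $\rho\to+\infty$ corresponds to the north pole $N$ and $\rho\to-\infty$ to the south pole $S$. The vector field is carried to the sphere minus the poles by the differential of this map. The Poincaré index $i_N$ (resp. $i_S$) is the index of the projected vector field at $N$ (resp. $S$), i.e. the total number of positive rotations of the direction of the vector field, measured in a local oriented chart of the sphere around the pole, along a small positively oriented simple closed curve around the pole enclosing no other critical point. *)

theory Defs
  imports "HOL-Complex_Analysis.Complex_Analysis"
begin

text \<open>
  The Euclidean plane is modelled by the complex numbers, with Cartesian components
  \<open>Re\<close>, \<open>Im\<close> and the usual orientation. A curve on \<open>\<real>/l\<int>\<close> is a
  function on the reals with period \<open>l\<close>.
\<close>

definition smooth_curve :: "(real \<Rightarrow> complex) \<Rightarrow> bool" where
  "smooth_curve \<alpha> \<longleftrightarrow>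
     (\<exists>D :: nat \<Rightarrow> real \<Rightarrow> complex. D 0 = \<alpha> \<and>
        (\<forall>n s. (D n has_vector_derivative D (Suc n) s) (at s)))"

definition closed_arclength_curve :: "real \<Rightarrow> (real \<Rightarrow> complex) \<Rightarrow> bool" where
  "closed_arclength_curve l \<alpha> \<longleftrightarrow>
     0 < l \<and> smooth_curve \<alpha> \<and> (\<forall>s. \<alpha> (s + l) = \<alpha> s) \<and>
     (\<forall>s. norm (vector_derivative \<alpha> (at s)) = 1)"

definition tangent_vec :: "(real \<Rightarrow> complex) \<Rightarrow> real \<Rightarrow> complex" where
  "tangent_vec \<alpha> s = vector_derivative \<alpha> (at s)"

text \<open>Multiplication by \<open>\<i>\<close> is the rotation by \<open>+\<pi>/2\<close>, so \<open>(t, n)\<close> is right-handed.\<close>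

definition normal_vec :: "(real \<Rightarrow> complex) \<Rightarrow> real \<Rightarrow> complex" where
  "normal_vec \<alpha> s = \<i> * tangent_vec \<alpha> s"

definition curvature :: "(real \<Rightarrow> complex) \<Rightarrow> real \<Rightarrow> real" where
  "curvature \<alpha> s =
     (THE k. vector_derivative (tangent_vec \<alpha>) (at s) = k *\<^sub>R normal_vec \<alpha> s)"

text \<open>
  Degree of a continuous map from \<open>\<real>/l\<int>\<close> to the unit circle: the number of turns of the
  loop it defines (compare \<open>winding_number_as_continuous_log\<close>).
\<close>

definition circle_degree :: "real \<Rightarrow> (real \<Rightarrow> complex) \<Rightarrow> int" where
  "circle_degree l g = (THE d. winding_number (\<lambda>u. g (l * u)) 0 = of_int d)"

definition rotation_index :: "real \<Rightarrow> (real \<Rightarrow> complex) \<Rightarrow> int" where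
  "rotation_index l \<alpha> =
     circle_degree l (\<lambda>s. tangent_vec \<alpha> s / of_real (norm (tangent_vec \<alpha> s)))"

definition normal_map :: "(real \<Rightarrow> complex) \<Rightarrow> real \<times> real \<Rightarrow> complex" where
  "normal_map \<alpha> = (\<lambda>(s, \<rho>). \<alpha> s + \<rho> *\<^sub>R normal_vec \<alpha> s)"

text \<open>
  The cylinder of circumference \<open>l\<close> about the third axis, and the sphere of the same radius
  centred at the origin. With this parametrisation \<open>\<partial>\<^sub>s \<times> \<partial>\<^sub>\<rho>\<close> points outward.
\<close>

definition cyl_radius :: "real \<Rightarrow> real" where
  "cyl_radius l = l / (2 * pi)"

definition cylinder_point :: "real \<Rightarrow> real \<times> real \<Rightarrow> real ^ 3" where
  "cylinder_point l = (\<lambda>(s, \<rho>).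
     vector [cyl_radius l * cos (s / cyl_radius l), cyl_radius l * sin (s / cyl_radius l), \<rho>])"

definition sphere_proj :: "real \<Rightarrow> real \<times> real \<Rightarrow> real ^ 3" where
  "sphere_proj l q =
     (THE P. P \<in> closed_segment (cylinder_point l q) 0 \<and> P \<in> sphere 0 (cyl_radius l))"

definition north_pole :: "real \<Rightarrow> real ^ 3" where
  "north_pole l = vector [0, 0, cyl_radius l]"

definition south_pole :: "real \<Rightarrow> real ^ 3" where
  "south_pole l = vector [0, 0, - cyl_radius l]"

text \<open>
  Push-forward of the vector field \<open>G\<^sub>1 \<partial>\<^sub>s + G\<^sub>2 \<partial>\<^sub>\<rho>\<close> on the cylinder by the differential of
  the projection, as a tangent field of the sphere in space. Values at the poles (and off the
  sphere) are irrelevant.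
\<close>

definition push_to_sphere ::
    "real \<Rightarrow> (real \<times> real \<Rightarrow> complex) \<Rightarrow> real ^ 3 \<Rightarrow> real ^ 3" where
  "push_to_sphere l G P =
     (let q = inv_into ({0..<l} \<times> UNIV) (sphere_proj l) P
      in frechet_derivative (sphere_proj l) (at q) (Re (G q), Im (G q)))"

text \<open>
  An oriented chart of the sphere of radius \<open>R\<close> is given by its inverse, a regular
  parametrisation \<open>\<psi>\<close> of an open part of the sphere. The orientation is that of the outward
  normal. Only \<open>C\<^sup>1\<close> regularity is asked for, so the smooth charts are included.
\<close>

definition oriented_chart :: "real \<Rightarrow> complex set \<Rightarrow> (complex \<Rightarrow> real ^ 3) \<Rightarrow> bool" where
  "oriented_chart R U \<psi> \<longleftrightarrow>
     open U \<and> openin (top_of_set (sphere 0 R)) (\<psi> ` U) \<and>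
     (\<exists>\<phi>. homeomorphism U (\<psi> ` U) \<psi> \<phi>) \<and>
     (\<forall>z\<in>U. \<psi> differentiable (at z)) \<and>
     (\<forall>v. continuous_on U (\<lambda>z. frechet_derivative \<psi> (at z) v)) \<and>
     (\<forall>z\<in>U. cross3 (frechet_derivative \<psi> (at z) 1) (frechet_derivative \<psi> (at z) \<i>) \<bullet> \<psi> z > 0)"

definition chart_field ::
    "(complex \<Rightarrow> real ^ 3) \<Rightarrow> (real ^ 3 \<Rightarrow> real ^ 3) \<Rightarrow> complex \<Rightarrow> complex" where
  "chart_field \<psi> W z = (THE v. frechet_derivative \<psi> (at z) v = W (\<psi> z))"

text \<open>
  Index of a planar vector field at a point, at which the field itself need not be defined.
  A simple closed curve is positively oriented around \<open>z\<^sub>0\<close> iff its winding number about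
  \<open>z\<^sub>0\<close> is 1.
\<close>

definition has_planar_index :: "(complex \<Rightarrow> complex) \<Rightarrow> complex \<Rightarrow> int \<Rightarrow> bool" where
  "has_planar_index X z\<^sub>0 i \<longleftrightarrow>
     (\<exists>\<epsilon>>0. continuous_on (ball z\<^sub>0 \<epsilon> - {z\<^sub>0}) X \<and> (\<forall>z \<in> ball z\<^sub>0 \<epsilon> - {z\<^sub>0}. X z \<noteq> 0) \<and>
        (\<forall>\<gamma>. simple_path \<gamma> \<and> pathfinish \<gamma> = pathstart \<gamma> \<and>
             path_image \<gamma> \<subseteq> ball z\<^sub>0 \<epsilon> - {z\<^sub>0} \<and> winding_number \<gamma> z\<^sub>0 = 1
             \<longrightarrow> winding_number (X \<circ> \<gamma>) 0 = of_int i))"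

text \<open>
  The index on the sphere must come out the same in every oriented chart around the point.
  The first conjunct keeps the second from holding vacuously, so \<open>i\<close> is unique.
\<close>

definition has_poincare_index ::
    "real \<Rightarrow> (real ^ 3 \<Rightarrow> real ^ 3) \<Rightarrow> real ^ 3 \<Rightarrow> int \<Rightarrow> bool" where
  "has_poincare_index R W p i \<longleftrightarrow>
     (\<exists>U \<psi>. oriented_chart R U \<psi> \<and> p \<in> \<psi> ` U) \<and>
     (\<forall>U \<psi> z\<^sub>0. oriented_chart R U \<psi> \<and> z\<^sub>0 \<in> U \<and> \<psi> z\<^sub>0 = p
        \<longrightarrow> has_planar_index (chart_field \<psi> W) z\<^sub>0 i)"

end

theory Submission
  imports Defs
begin

text \<open>
  Let \<open>F\<close> be the normal map, \<open>t\<close> the tangent, \<open>n = i t\<close> the normal and \<open>r\<close> the rotation index of the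
  curve, \<open>R\<close> the radius of the sphere and \<open>\<lambda>\<close> the latitude. The projection sends \<open>(s, \<rho>)\<close> to
  longitude \<open>s / R\<close> and latitude \<open>arctan (\<rho> / R)\<close>, so its differential carries \<open>\<partial>\<^sub>s\<close> and \<open>\<partial>\<^sub>\<rho>\<close> to
  \<open>cos \<lambda>\<close> times the unit east vector and \<open>cos\<^sup>2 \<lambda>\<close> times the unit north vector. Going once around a
  pole, three things contribute to the rotation of the projected field.

  First, the frame (east, north) itself. Seen in an oriented plane at either pole it makes one
  positive turn; this is the summand 1. Second, the components of the field in this frame are those
  of \<open>F\<close> up to positive factors. A positive diagonal rescaling turns a vector by less than a right
  angle and so preserves the number of turns. Third, \<open>F = \<alpha> + \<rho> n\<close> with \<open>\<alpha>\<close> bounded and \<open>\<bar>\<rho>\<bar>\<close>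
  tending to infinity at the poles, so close to them \<open>F\<close> makes an acute angle with \<open>n\<close> (or with
  \<open>-n\<close>) and turns as often as \<open>n\<close>, that is, as often as the tangent. This is \<open>r\<close> turns around the
  north pole; around the south pole the longitude decreases along a positively oriented loop, and it
  is \<open>-r\<close> turns.

  The comparison of turns rests on \<open>winding_number_eq_acute_angle\<close>, by which two planar loops
  enclosing an acute angle at every time have the same winding number, and on the additivity of
  winding numbers under pointwise multiplication.

  The index has to be found in every oriented chart and on every admissible loop. Both are reduced
  to the orthogonal projection onto the equatorial plane: an orientation-preserving \<open>C\<^sup>1\<close> change of
  coordinates is close to its linear part, which preserves the winding numbers of loops and of
  fields along them (\<open>has_planar_index_local_diffeo\<close>, \<open>has_planar_index_chart_field\<close>), and an
  arbitrary loop of winding number 1 in the plane is lifted to polar coordinates by a continuous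
  logarithm (\<open>projected_field_index\<close>).

  Both poles are treated at once through a sign \<open>\<sigma>\<close>, equal to 1 in the north and to -1 in the south.
\<close>

section \<open>Winding numbers of planar loops\<close>

text \<open>
  Continuous logarithms of the two paths add up to a logarithm of the product.
\<close>

lemma winding_number_mult:
  assumes "path p" "path q" "0 \<notin> path_image p" "0 \<notin> path_image q"
  shows "winding_number (\<lambda>t. p t * q t) 0 = winding_number p 0 + winding_number q 0"
proof -
  obtain f where f: "path f" "pathfinish f - pathstart f = 2 * of_real pi * \<i> * winding_number p 0"
      "\<And>t. t \<in> {0..1} \<Longrightarrow> p t = 0 + exp (f t)"
    using winding_number_as_continuous_log assms(1,3) by blast
  obtain g where g: "path g" "pathfinish g - pathstart g = 2 * of_real pi * \<i> * winding_number q 0"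
      "\<And>t. t \<in> {0..1} \<Longrightarrow> q t = 0 + exp (g t)"
    using winding_number_as_continuous_log assms(2,4) by blast
  have pfg: "path (\<lambda>t. f t + g t)"
    using f(1) g(1) unfolding path_def by (intro continuous_intros)
  have "winding_number (\<lambda>t. p t * q t) 0 = winding_number (exp \<circ> (\<lambda>t. f t + g t)) 0"
    by (rule winding_number_cong) (simp add: f(3) g(3) exp_add)
  also have "\<dots> = (pathfinish (\<lambda>t. f t + g t) - pathstart (\<lambda>t. f t + g t)) / (2 * of_real pi * \<i>)"
    by (rule winding_number_compose_exp[OF pfg])
  also have "\<dots> = ((pathfinish f - pathstart f) + (pathfinish g - pathstart g)) / (2 * of_real pi * \<i>)"
    by (simp add: pathfinish_def pathstart_def)
  also have "\<dots> = winding_number p 0 + winding_number q 0"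
    unfolding f(2) g(2) by (simp add: field_simps)
  finally show ?thesis .
qed

text \<open>
  The quotient of the two loops stays in the right half-plane, which is convex and omits 0, so it does
  not wind around 0.
\<close>

lemma winding_number_eq_acute_angle:
  assumes "path p" "path q" "pathfinish p = pathstart p" "pathfinish q = pathstart q"
    and acute: "\<And>t. t \<in> {0..1} \<Longrightarrow> Re (cnj (p t) * q t) > 0"
  shows "winding_number q 0 = winding_number p 0"
proof -
  define h where "h = (\<lambda>t. q t / p t)"
  have p0: "p t \<noteq> 0" if "t \<in> {0..1}" for t
    using acute[OF that] by auto
  have "path h"
    unfolding h_def path_def using assms(1,2) p0 unfolding path_def
    by (intro continuous_intros) auto
  have Re_h: "Re (h t) > 0" if "t \<in> {0..1}" for t
  proof -
    have "h t = (cnj (p t) * q t) / of_real ((norm (p t))\<^sup>2)"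
      using p0[OF that] unfolding h_def complex_norm_square by (simp add: field_simps)
    then show ?thesis
      using acute[OF that] p0[OF that] by (simp add: Re_divide_of_real)
  qed
  have "winding_number h 0 = 0"
  proof (rule winding_number_zero_outside[where s = "{z. Re z > 0}"])
    show "path h" by fact
    show "convex {z. Re z > 0}" by (rule convex_halfspace_Re_gt)
    show "pathfinish h = pathstart h"
      using assms(3,4) by (simp add: h_def pathfinish_def pathstart_def)
  qed (use Re_h in \<open>auto simp: path_image_def\<close>)
  moreover have "winding_number q 0 = winding_number (\<lambda>t. p t * h t) 0"
    by (rule winding_number_cong) (use p0 in \<open>simp add: h_def\<close>)
  moreover have "winding_number (\<lambda>t. p t * h t) 0 = winding_number p 0 + winding_number h 0"
  proof (rule winding_number_mult)
    show "0 \<notin> path_image p" using p0 by (auto simp: path_image_def)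
    show "0 \<notin> path_image h" using Re_h by (force simp: path_image_def)
  qed (use assms \<open>path h\<close> in auto)
  ultimately show ?thesis by simp
qed

lemma winding_number_rouche:
  assumes "path p" "path q" "pathfinish p = pathstart p" "pathfinish q = pathstart q"
    and "\<And>t. t \<in> {0..1} \<Longrightarrow> norm (q t - p t) < norm (p t)"
  shows "winding_number q 0 = winding_number p 0"
proof (rule winding_number_eq_acute_angle[OF assms(1-4)])
  fix t :: real assume t: "t \<in> {0..1}"
  have p: "norm (p t) > 0"
    using assms(5)[OF t] norm_ge_zero[of "q t - p t"] by linarith
  have "\<bar>Re (cnj (p t) * (q t - p t))\<bar> \<le> norm (p t) * norm (q t - p t)"
    using abs_Re_le_cmod[of "cnj (p t) * (q t - p t)"] by (simp add: norm_mult)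
  also have "\<dots> < norm (p t) * norm (p t)"
    using assms(5)[OF t] p by simp
  also have "\<dots> = Re (cnj (p t) * p t)"
    using cmod_power2[of "p t"] by (simp add: power2_eq_square)
  finally show "0 < Re (cnj (p t) * q t)"
    by (simp add: algebra_simps)
qed

text \<open>
  A real-linear map of the plane is \<open>v \<mapsto> a v + b cnj v\<close> with Jacobian \<open>\<bar>a\<bar>\<^sup>2 - \<bar>b\<bar>\<^sup>2\<close>. If this is
  positive the first term dominates, and multiplication by \<open>a\<close> is a rotation and a dilation.
\<close>

lemma winding_number_orientation_preserving_linear:
  assumes "path c" "pathfinish c = pathstart c" "0 \<notin> path_image c" "norm b < norm a"
  shows "winding_number (\<lambda>t. a * c t + b * cnj (c t)) 0 = winding_number c 0"
proof -
  have a: "a \<noteq> 0" using assms(4) by auto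
  have c0: "c t \<noteq> 0" if "t \<in> {0..1}" for t
    using assms(3) that by (force simp: path_image_def)
  have "winding_number (\<lambda>t. a * c t + b * cnj (c t)) 0 = winding_number (\<lambda>t. a * c t) 0"
    by (rule winding_number_rouche)
      (use assms(1,2,4) c0 in \<open>auto simp: path_def pathfinish_def pathstart_def norm_mult
         intro!: continuous_intros mult_strict_right_mono\<close>)
  also have "\<dots> = winding_number (\<lambda>t. a) 0 + winding_number c 0"
    by (rule winding_number_mult) (use a assms(1,3) in \<open>auto simp: path_def path_image_def\<close>)
  also have "winding_number (\<lambda>t. a) 0 = 0"
    by (rule winding_number_constI[of a]) (use a in auto)
  finally show ?thesis by simp
qed

section \<open>Periodic functions of a real parameter\<close>

lemma periodic_of_int:
  fixes f :: "real \<Rightarrow> 'a"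
  assumes "\<And>x. f (x + p) = f x"
  shows "f (x + of_int n * p) = f x"
proof (induction n rule: int_induct[where k = 0])
  case (step1 i)
  then show ?case using assms[of "x + of_int i * p"] by (simp add: algebra_simps)
next
  case (step2 i)
  then show ?case using assms[of "x + of_int (i - 1) * p"] by (simp add: algebra_simps)
qed simp

lemma bounded_continuous_periodic:
  fixes f :: "real \<Rightarrow> 'a::real_normed_vector"
  assumes "0 < l" "continuous_on UNIV f" "\<And>s. f (s + l) = f s"
  obtains M where "M > 0" "\<And>s. norm (f s) \<le> M"
proof -
  have "compact (f ` {0..l})"
    by (rule compact_continuous_image[OF continuous_on_subset[OF assms(2)]]) auto
  then obtain M where M: "M > 0" "\<And>s. s \<in> {0..l} \<Longrightarrow> norm (f s) \<le> M"
    using compact_imp_bounded bounded_pos by (metis imageI)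
  have "norm (f s) \<le> M" for s
  proof -
    define k where "k = \<lfloor>s / l\<rfloor>"
    have "of_int k \<le> s / l" "s / l < of_int k + 1" unfolding k_def by linarith+
    then have "s + of_int (- k) * l \<in> {0..l}"
      using assms(1) by (auto simp: field_simps)
    then show ?thesis using M(2) periodic_of_int[of f l s "- k"] assms(3) by metis
  qed
  then show ?thesis using that M(1) by blast
qed

text \<open>
  The number of turns depends only on the net increment of the parameter, not on how the parameter
  travels.
\<close>

lemma winding_number_periodic_comp:
  fixes g :: "real \<Rightarrow> complex"
  assumes g: "continuous_on UNIV g" "\<And>x. g (x + l) = g x" "\<And>x. g x \<noteq> 0"
    and s: "path s" "pathfinish s = pathstart s + l"
  shows "winding_number (g \<circ> s) 0 = winding_number (\<lambda>u. g (l * u)) 0"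
proof (rule winding_number_homotopic_loops)
  \<comment> \<open>During the straight-line homotopy of parameters the total increment stays \<open>l\<close>, so every
    intermediate curve remains a loop.\<close>
  define h where "h = (\<lambda>x::real \<times> real. g ((1 - fst x) * s (snd x) + fst x * (l * snd x)))"
  have sc: "continuous_on {0..1} s" using s(1) by (simp add: path_def)
  have "continuous_on ({0..1} \<times> {0..1}) h"
    unfolding h_def
    by (rule continuous_on_compose2[OF g(1)])
      (auto intro!: continuous_intros continuous_on_compose2[OF sc])
  moreover have "h (u, 1) = h (u, 0)" for u
  proof -
    have "(1 - u) * s 1 + u * l = (1 - u) * s 0 + l"
      using s(2) by (simp add: pathfinish_def pathstart_def algebra_simps)
    then show ?thesis unfolding h_def by (simp add: g(2))
  qed
  ultimately show "homotopic_loops (- {0}) (g \<circ> s) (\<lambda>u. g (l * u))"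
    unfolding homotopic_loops
    by (intro exI[of _ h]) (auto simp: h_def g(3) pathfinish_def pathstart_def)
qed

lemma periodic_Arg_exp:
  assumes "\<And>x. f (x + 2 * pi) = f x"
  shows "f (Arg (exp z)) = f (Im z)"
proof -
  have "exp (Ln (exp z)) = exp z" by simp
  then obtain n :: int where "Ln (exp z) = z + of_real (of_int (2 * n) * pi) * \<i>"
    unfolding exp_eq by blast
  then have "Arg (exp z) = Im z + of_int n * (2 * pi)"
    by (simp add: Arg_eq_Im_Ln)
  then show ?thesis using periodic_of_int[of f, OF assms] by simp
qed

lemma continuous_on_periodic_Arg:
  fixes f :: "real \<Rightarrow> 'a::topological_space"
  assumes "continuous_on UNIV f" "\<And>x. f (x + 2 * pi) = f x"
  shows "continuous_on (- {0}) (\<lambda>z. f (Arg z))"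
proof -
  have f: "f (x - 2 * pi) = f x" for x using assms(2)[of "x - 2 * pi"] by simp
  have c: "isCont f x" for x
    using assms(1) by (simp add: continuous_on_eq_continuous_at)
  \<comment> \<open>Across the branch cut of \<open>Arg\<close>, the branch \<open>Im (Ln (- z)) + pi\<close> is continuous and differs from
    \<open>Arg\<close> by a period.\<close>
  have alt: "f (Arg z) = f (Im (Ln (- z)) + pi)" if "z \<noteq> 0" for z
  proof -
    have "Im (Ln z) = Im (Ln (- z)) + pi \<or> Im (Ln z) = Im (Ln (- z)) - pi"
      using Ln_minus[OF that] by auto
    then show ?thesis
      using f[of "Im (Ln (- z)) + pi"] that by (auto simp: Arg_eq_Im_Ln)
  qed
  have "isCont (\<lambda>z. f (Arg z)) z" if z: "z \<noteq> 0" for z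
  proof (cases "z \<in> \<real>\<^sub>\<le>\<^sub>0")
    case False
    then show ?thesis
      using isCont_o2[OF continuous_at_Arg[OF False] c] by simp
  next
    case True
    then have "- z \<notin> \<real>\<^sub>\<le>\<^sub>0" using z
      by (auto simp: complex_nonpos_Reals_iff complex_eq_iff)
    then have "isCont (\<lambda>z. Im (Ln (- z)) + pi) z"
      by (intro continuous_intros) auto
    from this c have 1: "isCont (\<lambda>z. f (Im (Ln (- z)) + pi)) z"
      by (rule isCont_o2)
    have "eventually (\<lambda>w. w \<noteq> 0) (nhds z)"
      using z by (simp add: t1_space_nhds)
    then have "eventually (\<lambda>w. f (Arg w) = f (Im (Ln (- w)) + pi)) (nhds z)"
      by eventually_elim (rule alt)
    then show ?thesis
      using 1 by (simp add: isCont_cong)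
  qed
  then show ?thesis
    by (simp add: continuous_at_imp_continuous_on)
qed

section \<open>Invariance of the planar index under local diffeomorphisms\<close>

lemma norm_linear_ge:
  fixes a b v :: complex
  shows "(norm a - norm b) * norm v \<le> norm (a * v + b * cnj v)"
  using norm_diff_ineq[of "a * v" "b * cnj v"] by (simp add: norm_mult left_diff_distrib)

lemma orientation_preserving_linear_inverse:
  fixes a b v y :: complex
  assumes "norm b < norm a"
  shows "a * v + b * cnj v = y \<longleftrightarrow>
    v = (cnj a * y - b * cnj y) / of_real ((norm a)\<^sup>2 - (norm b)\<^sup>2)"
proof -
  have "(norm b)\<^sup>2 < (norm a)\<^sup>2" using assms by (simp add: power_strict_mono)
  then have d: "a * cnj a - b * cnj b \<noteq> 0"
    by (metis complex_norm_square eq_iff_diff_eq_0 less_irrefl of_real_eq_iff)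
  have *: "v = (cnj a * y - b * cnj y) / of_real ((norm a)\<^sup>2 - (norm b)\<^sup>2) \<longleftrightarrow>
      v * (a * cnj a - b * cnj b) = cnj a * y - b * cnj y"
    using d unfolding of_real_diff complex_norm_square by (simp add: eq_divide_eq)
  show ?thesis unfolding *
  proof
    assume "a * v + b * cnj v = y"
    then show "v * (a * cnj a - b * cnj b) = cnj a * y - b * cnj y"
      by (auto simp: algebra_simps)
  next
    assume v: "v * (a * cnj a - b * cnj b) = cnj a * y - b * cnj y"
    then have "cnj v * (a * cnj a - b * cnj b) = a * cnj y - cnj b * y"
      using arg_cong[OF v, of cnj] by (simp add: algebra_simps)
    then have "(a * v + b * cnj v) * (a * cnj a - b * cnj b) = y * (a * cnj a - b * cnj b)"
      using v by algebra
    then show "a * v + b * cnj v = y" using d by simp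
  qed
qed

text \<open>
  Coordinate invariance of the index: \<open>\<eta>\<close> is the change of coordinates, the continuous family of linear
  maps \<open>v \<mapsto> a v + b cnj v\<close> plays its derivative, and \<open>Y\<close> is the field \<open>X\<close> in the new coordinates. Near
  \<open>z\<^sub>0\<close> both \<open>\<eta>\<close> and the family are close to the derivative at \<open>z\<^sub>0\<close>, and a linear map of positive
  Jacobian alters neither the winding number of the loop nor that of the field along it.

  The hypothesis on \<open>Y\<close> asks for all loops of winding number 1, not only simple ones, so that nothing
  has to be known about the image of a simple loop.
\<close>

lemma has_planar_index_local_diffeo:
  fixes \<eta> X Y a b :: "complex \<Rightarrow> complex"
  assumes U: "open U" "z\<^sub>0 \<in> U" and "r > 0"
    and cont: "continuous_on U \<eta>" "continuous_on U a" "continuous_on U b"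
    and \<eta>0: "\<eta> z\<^sub>0 = 0"
    and deriv: "(\<eta> has_derivative (\<lambda>v. a z\<^sub>0 * v + b z\<^sub>0 * cnj v)) (at z\<^sub>0)"
    and jac: "\<And>z. z \<in> U \<Longrightarrow> norm (b z) < norm (a z)"
    and XY: "\<And>z. z \<in> U - {z\<^sub>0} \<Longrightarrow> \<eta> z \<in> ball 0 r - {0} \<Longrightarrow> a z * X z + b z * cnj (X z) = Y (\<eta> z)"
    and Y: "continuous_on (ball 0 r - {0}) Y" "\<And>w. w \<in> ball 0 r - {0} \<Longrightarrow> Y w \<noteq> 0"
    and index: "\<And>c. path c \<Longrightarrow> pathfinish c = pathstart c \<Longrightarrow> path_image c \<subseteq> ball 0 r - {0} \<Longrightarrow>
        winding_number c 0 = 1 \<Longrightarrow> winding_number (Y \<circ> c) 0 = of_int i"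
  shows "has_planar_index X z\<^sub>0 i"
proof -
  define A where "A = (\<lambda>v. a z\<^sub>0 * v + b z\<^sub>0 * cnj v)"
  define \<kappa> where "\<kappa> = norm (a z\<^sub>0) - norm (b z\<^sub>0)"
  have \<kappa>: "\<kappa> > 0" using jac[OF U(2)] by (simp add: \<kappa>_def)
  have A_ge: "\<kappa> * norm v \<le> norm (A v)" for v
    unfolding A_def \<kappa>_def by (rule norm_linear_ge)
  obtain d1 where d1: "d1 > 0" "ball z\<^sub>0 d1 \<subseteq> U"
    using U open_contains_ball by blast
  obtain d2 where d2: "d2 > 0"
    "\<And>z. norm (z - z\<^sub>0) < d2 \<Longrightarrow> norm (\<eta> z - \<eta> z\<^sub>0 - A (z - z\<^sub>0)) \<le> \<kappa> / 2 * norm (z - z\<^sub>0)"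
    using deriv half_gt_zero[OF \<kappa>] unfolding has_derivative_at_alt A_def by blast
  have tends: "\<exists>d>0. \<forall>z. dist z z\<^sub>0 < d \<longrightarrow> dist (f z) (f z\<^sub>0) < e"
    if "continuous_on U f" "e > 0" for f :: "complex \<Rightarrow> complex" and e
  proof -
    have "isCont f z\<^sub>0"
      using that(1) U(2) continuous_on_eq_continuous_at[OF U(1)] by blast
    then show ?thesis using that(2) by (simp add: continuous_at_eps_delta)
  qed
  obtain d3 where d3: "d3 > 0" "\<And>z. dist z z\<^sub>0 < d3 \<Longrightarrow> dist (\<eta> z) (\<eta> z\<^sub>0) < r"
    using tends[OF cont(1) \<open>r > 0\<close>] by blast
  obtain d4 where d4: "d4 > 0" "\<And>z. dist z z\<^sub>0 < d4 \<Longrightarrow> dist (a z) (a z\<^sub>0) < \<kappa> / 2"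
    using tends[OF cont(2), of "\<kappa> / 2"] \<kappa> by auto
  obtain d5 where d5: "d5 > 0" "\<And>z. dist z z\<^sub>0 < d5 \<Longrightarrow> dist (b z) (b z\<^sub>0) < \<kappa> / 2"
    using tends[OF cont(3), of "\<kappa> / 2"] \<kappa> by auto
  define \<epsilon> where "\<epsilon> = Min {d1, d2, d3, d4, d5}"
  have \<epsilon>: "\<epsilon> > 0" "\<epsilon> \<le> d1" "\<epsilon> \<le> d2" "\<epsilon> \<le> d3" "\<epsilon> \<le> d4" "\<epsilon> \<le> d5"
    using d1 d2 d3 d4 d5 by (auto simp: \<epsilon>_def)
  define B where "B = ball z\<^sub>0 \<epsilon> - {z\<^sub>0}"
  have BU: "z \<in> U - {z\<^sub>0}" if "z \<in> B" for z
    using that \<epsilon> d1 by (auto simp: B_def)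
  \<comment> \<open>Likewise \<open>\<eta>\<close> differs from its linear part by less than the length of the latter.\<close>
  have lin: "norm (\<eta> z - A (z - z\<^sub>0)) < norm (A (z - z\<^sub>0))" if "z \<in> B" for z
  proof -
    have z: "norm (z - z\<^sub>0) < d2" "norm (z - z\<^sub>0) > 0"
      using that \<epsilon> by (auto simp: B_def dist_norm norm_minus_commute)
    have "norm (\<eta> z - A (z - z\<^sub>0)) \<le> \<kappa> / 2 * norm (z - z\<^sub>0)"
      using d2(2)[OF z(1)] \<eta>0 by simp
    also have "\<dots> < \<kappa> * norm (z - z\<^sub>0)" using z(2) \<kappa> by simp
    also have "\<dots> \<le> norm (A (z - z\<^sub>0))" by (rule A_ge)
    finally show ?thesis .
  qed
  have \<eta>_B: "\<eta> z \<in> ball 0 r - {0}" if "z \<in> B" for z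
  proof -
    have "dist z z\<^sub>0 < d3" using that \<epsilon> by (auto simp: B_def dist_commute)
    then show ?thesis using d3(2) lin[OF that] \<eta>0 by auto
  qed
  have X_eq: "a z * X z + b z * cnj (X z) = Y (\<eta> z)" if "z \<in> B" for z
    using XY[OF BU[OF that] \<eta>_B[OF that]] .
  have X_nz: "X z \<noteq> 0" if "z \<in> B" for z
    using X_eq[OF that] Y(2)[OF \<eta>_B[OF that]] by auto
  have contB: "continuous_on B \<eta>" "continuous_on B a" "continuous_on B b"
    using BU by (auto intro!: cont[THEN continuous_on_subset])
  have "continuous_on B (\<lambda>z. Y (\<eta> z))"
    by (rule continuous_on_compose2[OF Y(1) contB(1)]) (rule image_subsetI[OF \<eta>_B])
  then have "continuous_on B (\<lambda>z. (cnj (a z) * Y (\<eta> z) - b z * cnj (Y (\<eta> z))) /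
      of_real ((norm (a z))\<^sup>2 - (norm (b z))\<^sup>2))"
  proof (intro continuous_intros contB ballI)
    fix z assume "z \<in> B"
    then have "norm (b z) \<noteq> norm (a z)"
      using jac[of z] BU[of z] by auto
    then show "complex_of_real ((norm (a z))\<^sup>2 - (norm (b z))\<^sup>2) \<noteq> 0"
      by (simp del: of_real_diff of_real_power)
  qed
  then have X_cont: "continuous_on B X"
  proof (rule continuous_on_eq)
    fix z assume z: "z \<in> B"
    then have "norm (b z) < norm (a z)" using jac BU by blast
    from orientation_preserving_linear_inverse[OF this] X_eq[OF z]
    show "(cnj (a z) * Y (\<eta> z) - b z * cnj (Y (\<eta> z))) /
        of_real ((norm (a z))\<^sup>2 - (norm (b z))\<^sup>2) = X z"
      by simp
  qed
  \<comment> \<open>Freezing the derivative at \<open>z\<^sub>0\<close> changes the transported field by less than its length.\<close>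
  have near_A: "norm (Y (\<eta> z) - A (X z)) < norm (A (X z))" if "z \<in> B" for z
  proof -
    have z: "dist z z\<^sub>0 < d4" "dist z z\<^sub>0 < d5"
      using that \<epsilon> by (auto simp: B_def dist_commute)
    have "Y (\<eta> z) - A (X z) = (a z - a z\<^sub>0) * X z + (b z - b z\<^sub>0) * cnj (X z)"
      unfolding X_eq[OF that, symmetric] A_def by (simp add: algebra_simps)
    then have "norm (Y (\<eta> z) - A (X z)) \<le> (norm (a z - a z\<^sub>0) + norm (b z - b z\<^sub>0)) * norm (X z)"
      by (metis norm_triangle_ineq norm_mult complex_mod_cnj distrib_right)
    also have "\<dots> < \<kappa> * norm (X z)"
      using d4(2)[OF z(1)] d5(2)[OF z(2)] X_nz[OF that]
      by (intro mult_strict_right_mono) (auto simp: dist_norm)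
    also have "\<dots> \<le> norm (A (X z))" by (rule A_ge)
    finally show ?thesis .
  qed
  show ?thesis unfolding has_planar_index_def
  proof (intro exI[of _ \<epsilon>] conjI allI impI ballI)
    fix \<gamma> :: "real \<Rightarrow> complex"
    assume "simple_path \<gamma> \<and> pathfinish \<gamma> = pathstart \<gamma> \<and> path_image \<gamma> \<subseteq> ball z\<^sub>0 \<epsilon> - {z\<^sub>0} \<and>
      winding_number \<gamma> z\<^sub>0 = 1"
    then have \<gamma>: "path \<gamma>" "pathfinish \<gamma> = pathstart \<gamma>" "path_image \<gamma> \<subseteq> B" "winding_number \<gamma> z\<^sub>0 = 1"
      by (auto simp: B_def simple_path_imp_path)
    have inB: "\<gamma> t \<in> B" if "t \<in> {0..1}" for t
      using \<gamma>(3) that by (auto simp: path_image_def)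
    have paths: "path (\<eta> \<circ> \<gamma>)" "path (X \<circ> \<gamma>)"
      using \<gamma>(1,3) contB(1) X_cont
      by (auto intro!: path_continuous_image elim: continuous_on_subset)
    have imY: "path_image (\<eta> \<circ> \<gamma>) \<subseteq> ball 0 r - {0}"
      unfolding path_image_def comp_def by (rule image_subsetI[OF \<eta>_B[OF inB]])
    have pathY: "path (Y \<circ> (\<eta> \<circ> \<gamma>))"
      by (rule path_continuous_image[OF paths(1) continuous_on_subset[OF Y(1) imY]])
    have X0: "0 \<notin> path_image (X \<circ> \<gamma>)"
      using inB X_nz by (force simp: path_image_def)
    have closed: "\<gamma> 1 = \<gamma> 0"
      using \<gamma>(2) by (simp add: pathfinish_def pathstart_def)
    have pathA: "path (\<lambda>t. A (c t))" if "path c" for c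
      using that unfolding A_def path_def by (intro continuous_intros)
    have shift: "path (\<lambda>t. \<gamma> t - z\<^sub>0)"
      using \<gamma>(1) unfolding path_def by (intro continuous_intros)
    have "winding_number (\<eta> \<circ> \<gamma>) 0 = winding_number (\<lambda>t. A (\<gamma> t - z\<^sub>0)) 0"
      by (rule winding_number_rouche)
        (use paths(1) pathA[OF shift] closed inB lin in \<open>auto simp: pathfinish_def pathstart_def\<close>)
    also have "\<dots> = winding_number (\<lambda>t. \<gamma> t - z\<^sub>0) 0"
      unfolding A_def
      by (rule winding_number_orientation_preserving_linear)
        (use shift closed inB jac[OF U(2)] in \<open>auto simp: pathfinish_def pathstart_def path_image_def B_def\<close>)
    also have "\<dots> = 1" using \<gamma>(4) winding_number_offset by metis
    finally have "winding_number (Y \<circ> (\<eta> \<circ> \<gamma>)) 0 = of_int i"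
      using index[of "\<eta> \<circ> \<gamma>"] paths(1) imY closed by (simp add: pathfinish_def pathstart_def)
    also have "winding_number (Y \<circ> (\<eta> \<circ> \<gamma>)) 0 = winding_number (\<lambda>t. A ((X \<circ> \<gamma>) t)) 0"
      by (rule winding_number_rouche)
        (use pathY pathA[OF paths(2)] closed inB near_A in \<open>auto simp: pathfinish_def pathstart_def\<close>)
    also have "\<dots> = winding_number (X \<circ> \<gamma>) 0"
      unfolding A_def
      by (rule winding_number_orientation_preserving_linear[OF paths(2) _ X0 jac[OF U(2)]])
        (use closed in \<open>simp add: pathfinish_def pathstart_def\<close>)
    finally show "winding_number (X \<circ> \<gamma>) 0 = of_int i" .
  qed (use \<epsilon>(1) X_cont X_nz in \<open>auto simp: B_def\<close>)
qed

section \<open>Tangent fields of the sphere in oriented charts\<close>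

lemma norm_vec3_squared: "(norm P)\<^sup>2 = (P $ 1)\<^sup>2 + (P $ 2)\<^sup>2 + (P $ 3)\<^sup>2" for P :: "real ^ 3"
  unfolding power2_norm_eq_inner by (simp add: inner_vec_def sum_3 power2_eq_square)

lemma has_derivative_vector3:
  fixes f g h :: "'a::real_normed_vector \<Rightarrow> real"
  assumes "(f has_derivative f') (at x within S)" "(g has_derivative g') (at x within S)"
    "(h has_derivative h') (at x within S)"
  shows "((\<lambda>x. vector [f x, g x, h x] :: real ^ 3) has_derivative (\<lambda>v. vector [f' v, g' v, h' v]))
    (at x within S)"
  unfolding has_derivative_componentwise_within[where 'b = "real ^ 3"]
  using assms by (auto simp: Basis_vec_def inner_axis UNIV_3)

lemma frechet_derivative_sphere_tangent:
  fixes f :: "'a::real_normed_vector \<Rightarrow> 'b::real_inner"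
  assumes "f differentiable (at x)" "open S" "x \<in> S" "\<And>y. y \<in> S \<Longrightarrow> norm (f y) = R"
  shows "frechet_derivative f (at x) v \<bullet> f x = 0"
proof -
  define D where "D = frechet_derivative f (at x)"
  have D: "(f has_derivative D) (at x)"
    using assms(1) frechet_derivative_works D_def by blast
  have "((\<lambda>y. f y \<bullet> f y) has_derivative (\<lambda>v. f x \<bullet> D v + D v \<bullet> f x)) (at x)"
    by (rule has_derivative_inner[OF D D])
  moreover have "((\<lambda>y. f y \<bullet> f y) has_derivative (\<lambda>v. 0)) (at x)"
  proof (rule has_derivative_transform_within_open[OF _ assms(2,3)])
    show "((\<lambda>y. R\<^sup>2) has_derivative (\<lambda>v. 0)) (at x)" by (rule has_derivative_const)
  qed (use assms(4) in \<open>simp flip: power2_norm_eq_inner\<close>)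
  ultimately have "(\<lambda>v. f x \<bullet> D v + D v \<bullet> f x) = (\<lambda>v. 0)"
    by (rule has_derivative_unique)
  then have "f x \<bullet> D v + D v \<bullet> f x = 0" by metis
  then show ?thesis by (simp add: inner_commute D_def)
qed

text \<open>
  Orthogonal projection onto the equatorial plane, reflected for \<open>\<sigma> = -1\<close>. The reflection makes it
  orientation preserving at the south pole, where the outward normal points down.
\<close>

definition equator_proj :: "real \<Rightarrow> real ^ 3 \<Rightarrow> complex" where
  "equator_proj \<sigma> P = Complex (P $ 1) (\<sigma> * P $ 2)"

lemma bounded_linear_equator_proj: "bounded_linear (equator_proj \<sigma>)"
  unfolding linear_conv_bounded_linear[symmetric]
  by (rule linearI) (simp_all add: equator_proj_def complex_eq_iff algebra_simps)

text \<open>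
  Off the equator a tangent vector is determined by its projection, the tangent plane not being
  vertical. So the third components of tangent fields never have to be computed.
\<close>

lemma equator_proj_eq_imp_eq_if_orthogonal:
  fixes P V W :: "real ^ 3"
  assumes "\<sigma> \<noteq> 0" "P $ 3 \<noteq> 0" "V \<bullet> P = 0" "W \<bullet> P = 0" "equator_proj \<sigma> V = equator_proj \<sigma> W"
  shows "V = W"
proof -
  have 12: "V $ 1 = W $ 1" "V $ 2 = W $ 2"
    using assms(1,5) by (auto simp: equator_proj_def)
  have "W $ 1 * P $ 1 + W $ 2 * P $ 2 + V $ 3 * P $ 3 = 0"
    "W $ 1 * P $ 1 + W $ 2 * P $ 2 + W $ 3 * P $ 3 = 0"
    using assms(3,4) by (simp_all add: inner_vec_def sum_3 12)
  then have "V $ 3 * P $ 3 = W $ 3 * P $ 3" by linarith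
  then show ?thesis using 12 assms(2) by (simp add: vec_eq_iff forall_3)
qed

lemma equator_proj_eq_imp_eq_on_hemisphere:
  fixes P Q :: "real ^ 3"
  assumes "\<sigma> \<noteq> 0" "P \<in> sphere 0 R" "Q \<in> sphere 0 R" "\<sigma> * P $ 3 > 0" "\<sigma> * Q $ 3 > 0"
    "equator_proj \<sigma> P = equator_proj \<sigma> Q"
  shows "P = Q"
proof -
  have 12: "P $ 1 = Q $ 1" "P $ 2 = Q $ 2"
    using assms(1,6) by (auto simp: equator_proj_def)
  have "(norm P)\<^sup>2 = (norm Q)\<^sup>2" using assms(2,3) by simp
  then have "(P $ 3)\<^sup>2 = (Q $ 3)\<^sup>2" unfolding norm_vec3_squared 12 by simp
  then have "P $ 3 = Q $ 3"
    using assms(4,5) by (auto simp: power2_eq_iff zero_less_mult_iff)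
  then show ?thesis using 12 by (simp add: vec_eq_iff forall_3)
qed

lemma oriented_chart_in_sphere:
  assumes "oriented_chart R U \<psi>" "z \<in> U"
  shows "\<psi> z \<in> sphere 0 R"
proof -
  have "openin (top_of_set (sphere 0 R)) (\<psi> ` U)"
    using assms(1) by (simp add: oriented_chart_def)
  then show ?thesis using openin_imp_subset assms(2) by blast
qed

lemma chart_derivative_tangent:
  assumes "oriented_chart R U \<psi>" "z \<in> U"
  shows "frechet_derivative \<psi> (at z) v \<bullet> \<psi> z = 0"
proof (rule frechet_derivative_sphere_tangent)
  show "\<psi> differentiable (at z)" "open U" "z \<in> U"
    using assms by (auto simp: oriented_chart_def)
  fix y assume "y \<in> U"
  then show "norm (\<psi> y) = R" using oriented_chart_in_sphere[OF assms(1)] by simp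
qed

text \<open>
  Turns the orientation condition of a chart, which involves the outward normal, into positivity of the
  Jacobian of the chart followed by the equatorial projection.
\<close>

lemma tangent_cross3_third_pos:
  assumes "u \<bullet> P = 0" "v \<bullet> P = 0" "cross3 u v \<bullet> P > 0" "\<sigma> * (P::real^3) $ 3 > 0"
  shows "\<sigma> * (cross3 u v) $ 3 > 0"
proof -
  define n where "n = cross3 u v"
  \<comment> \<open>\<open>n\<close> is normal to the plane of \<open>u\<close> and \<open>v\<close>, hence parallel to \<open>P\<close>.\<close>
  have "cross3 P n = 0"
    unfolding n_def Lagrange using assms(1,2) by (simp add: inner_commute)
  then have "(P \<bullet> n) *\<^sub>R P = (P \<bullet> P) *\<^sub>R n"
    using Lagrange[of P P n] by simp
  from arg_cong[OF this, of "\<lambda>V :: real ^ 3. \<sigma> * V $ 3"]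
  have "(P \<bullet> n) * (\<sigma> * P $ 3) = (P \<bullet> P) * (\<sigma> * n $ 3)" by (simp add: algebra_simps)
  moreover have "(P \<bullet> n) * (\<sigma> * P $ 3) > 0"
    using assms(3,4) by (simp add: n_def inner_commute)
  ultimately have "(P \<bullet> P) * (\<sigma> * n $ 3) > 0" by (simp only:)
  moreover have "P \<bullet> P \<ge> 0" by simp
  ultimately show ?thesis unfolding n_def by (metis zero_less_mult_iff not_less)
qed

definition wirtinger_dz :: "(complex \<Rightarrow> complex) \<Rightarrow> complex" where
  "wirtinger_dz L = (L 1 - \<i> * L \<i>) / 2"

definition wirtinger_dzbar :: "(complex \<Rightarrow> complex) \<Rightarrow> complex" where
  "wirtinger_dzbar L = (L 1 + \<i> * L \<i>) / 2"

lemma linear_wirtinger: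
  assumes "linear L"
  shows "L v = wirtinger_dz L * v + wirtinger_dzbar L * cnj v"
proof -
  have "v = Re v *\<^sub>R 1 + Im v *\<^sub>R \<i>" by (simp add: complex_eq_iff)
  then have "L v = L (Re v *\<^sub>R 1 + Im v *\<^sub>R \<i>)" by simp
  also have "\<dots> = Re v *\<^sub>R L 1 + Im v *\<^sub>R L \<i>"
    using assms by (simp add: linear_add linear_scale)
  also have "\<dots> = wirtinger_dz L * v + wirtinger_dzbar L * cnj v"
    by (simp add: wirtinger_dz_def wirtinger_dzbar_def complex_eq_iff field_simps)
  finally show ?thesis .
qed

lemma wirtinger_jacobian:
  "(norm (wirtinger_dz L))\<^sup>2 - (norm (wirtinger_dzbar L))\<^sup>2 = Re (L 1) * Im (L \<i>) - Im (L 1) * Re (L \<i>)"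
  unfolding cmod_power2 wirtinger_dz_def wirtinger_dzbar_def
  by (simp add: power2_eq_square field_simps)

text \<open>
  Reduces the index in an arbitrary oriented chart around a pole to the equatorial plane: chart followed
  by projection is an orientation-preserving local diffeomorphism that carries the chart field of \<open>W\<close> to
  the projected field \<open>Y\<close>.
\<close>

lemma has_planar_index_chart_field:
  fixes W :: "real ^ 3 \<Rightarrow> real ^ 3"
  assumes R: "R > 0" and \<sigma>: "\<sigma> = 1 \<or> \<sigma> = - 1"
    and chart: "oriented_chart R U \<psi>" "z\<^sub>0 \<in> U" "\<psi> z\<^sub>0 = vector [0, 0, \<sigma> * R]"
    and "r > 0"
    and WY: "\<And>P. P \<in> sphere 0 R \<Longrightarrow> \<sigma> * P $ 3 > 0 \<Longrightarrow> equator_proj \<sigma> P \<in> ball 0 r - {0} \<Longrightarrow>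
        W P \<bullet> P = 0 \<and> equator_proj \<sigma> (W P) = Y (equator_proj \<sigma> P)"
    and Y: "continuous_on (ball 0 r - {0}) Y" "\<And>w. w \<in> ball 0 r - {0} \<Longrightarrow> Y w \<noteq> 0"
    and index: "\<And>c. path c \<Longrightarrow> pathfinish c = pathstart c \<Longrightarrow> path_image c \<subseteq> ball 0 r - {0} \<Longrightarrow>
        winding_number c 0 = 1 \<Longrightarrow> winding_number (Y \<circ> c) 0 = of_int i"
  shows "has_planar_index (chart_field \<psi> W) z\<^sub>0 i"
proof -
  define D where "D = (\<lambda>z. frechet_derivative \<psi> (at z))"
  define L where "L = (\<lambda>z v. equator_proj \<sigma> (D z v))"
  \<comment> \<open>The projection is a diffeomorphism only on the open hemisphere around the pole.\<close>
  define V where "V = U \<inter> {z. \<sigma> * \<psi> z $ 3 > 0}"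
  have ch: "open U" "\<And>z. z \<in> U \<Longrightarrow> \<psi> differentiable (at z)"
    "\<And>v. continuous_on U (\<lambda>z. D z v)"
    "\<And>z. z \<in> U \<Longrightarrow> cross3 (D z 1) (D z \<i>) \<bullet> \<psi> z > 0"
    using chart(1) by (auto simp: oriented_chart_def D_def)
  have sph: "\<psi> z \<in> sphere 0 R" if "z \<in> U" for z
    by (rule oriented_chart_in_sphere[OF chart(1) that])
  have D: "(\<psi> has_derivative D z) (at z)" if "z \<in> U" for z
    using ch(2)[OF that] frechet_derivative_works D_def by metis
  have tang: "D z v \<bullet> \<psi> z = 0" if "z \<in> U" for z v
    unfolding D_def by (rule chart_derivative_tangent[OF chart(1) that])
  have \<psi>_cont: "continuous_on U \<psi>"
    using ch(1,2) by (simp add: continuous_on_eq_continuous_at differentiable_imp_continuous_within)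
  have V: "open V" "z\<^sub>0 \<in> V" "V \<subseteq> U"
  proof -
    have "continuous_on U (\<lambda>z. \<sigma> * \<psi> z $ 3)"
      by (intro continuous_intros \<psi>_cont)
    then have "open (U \<inter> (\<lambda>z. \<sigma> * \<psi> z $ 3) -` {0<..})"
      using ch(1) by (simp add: continuous_on_open_vimage Int_commute)
    also have "U \<inter> (\<lambda>z. \<sigma> * \<psi> z $ 3) -` {0<..} = V"
      by (auto simp: V_def)
    finally show "open V" .
    show "z\<^sub>0 \<in> V" using chart(2,3) \<sigma> R by (auto simp: V_def)
  qed (auto simp: V_def)
  have VD: "z \<in> U" "\<sigma> * \<psi> z $ 3 > 0" "\<psi> z $ 3 \<noteq> 0" if "z \<in> V" for z
    using that by (auto simp: V_def)
  have lin: "linear (L z)" if "z \<in> U" for z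
    unfolding L_def
    using has_derivative_bounded_linear[OF D[OF that]] bounded_linear_equator_proj
    by (intro bounded_linear.linear bounded_linear_compose[of "equator_proj \<sigma>" "D z"])
  have jac: "norm (wirtinger_dzbar (L z)) < norm (wirtinger_dz (L z))" if "z \<in> V" for z
  proof -
    have "0 < \<sigma> * cross3 (D z 1) (D z \<i>) $ 3"
      by (rule tangent_cross3_third_pos[OF tang tang ch(4)]) (use VD[OF that] in auto)
    also have "\<dots> = (norm (wirtinger_dz (L z)))\<^sup>2 - (norm (wirtinger_dzbar (L z)))\<^sup>2"
      unfolding wirtinger_jacobian cross_components by (simp add: L_def equator_proj_def algebra_simps)
    finally show ?thesis by (simp add: power_less_imp_less_base)
  qed
  have Lcont: "continuous_on V (\<lambda>z. L z v)" for v
    unfolding L_def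
    by (rule bounded_linear.continuous_on[OF bounded_linear_equator_proj continuous_on_subset[OF ch(3) V(3)]])
  show ?thesis
  proof (rule has_planar_index_local_diffeo[where U = V and r = r and Y = Y and \<eta> = "\<lambda>z. equator_proj \<sigma> (\<psi> z)"
        and a = "\<lambda>z. wirtinger_dz (L z)" and b = "\<lambda>z. wirtinger_dzbar (L z)"])
    show "continuous_on V (\<lambda>z. equator_proj \<sigma> (\<psi> z))"
      by (rule bounded_linear.continuous_on[OF bounded_linear_equator_proj continuous_on_subset[OF \<psi>_cont V(3)]])
    show "continuous_on V (\<lambda>z. wirtinger_dz (L z))" "continuous_on V (\<lambda>z. wirtinger_dzbar (L z))"
      unfolding wirtinger_dz_def wirtinger_dzbar_def by (intro continuous_intros Lcont; simp)+
    show "equator_proj \<sigma> (\<psi> z\<^sub>0) = 0"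
      unfolding chart(3) by (simp add: equator_proj_def complex_eq_iff)
    have "((\<lambda>z. equator_proj \<sigma> (\<psi> z)) has_derivative L z\<^sub>0) (at z\<^sub>0)"
      unfolding L_def by (rule bounded_linear.has_derivative[OF bounded_linear_equator_proj D[OF chart(2)]])
    moreover have "L z\<^sub>0 = (\<lambda>v. wirtinger_dz (L z\<^sub>0) * v + wirtinger_dzbar (L z\<^sub>0) * cnj v)"
      by (rule ext) (rule linear_wirtinger[OF lin[OF chart(2)]])
    ultimately show "((\<lambda>z. equator_proj \<sigma> (\<psi> z)) has_derivative
        (\<lambda>v. wirtinger_dz (L z\<^sub>0) * v + wirtinger_dzbar (L z\<^sub>0) * cnj v)) (at z\<^sub>0)"
      by simp
  next
    fix z assume z: "z \<in> V - {z\<^sub>0}" "equator_proj \<sigma> (\<psi> z) \<in> ball 0 r - {0}"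
    then have zV: "z \<in> V" by simp
    let ?a = "wirtinger_dz (L z)" and ?b = "wirtinger_dzbar (L z)" and ?y = "Y (equator_proj \<sigma> (\<psi> z))"
    have W: "W (\<psi> z) \<bullet> \<psi> z = 0" "equator_proj \<sigma> (W (\<psi> z)) = ?y"
      using WY[OF sph[OF VD(1)[OF zV]] VD(2)[OF zV] z(2)] by auto
    have *: "D z v = W (\<psi> z) \<longleftrightarrow> ?a * v + ?b * cnj v = ?y" for v
    proof -
      have "\<sigma> \<noteq> 0" using \<sigma> by auto
      then have "D z v = W (\<psi> z) \<longleftrightarrow> L z v = ?y"
        using equator_proj_eq_imp_eq_if_orthogonal[OF _ VD(3)[OF zV] tang[OF VD(1)[OF zV]] W(1)] W(2)
        by (auto simp: L_def)
      then show ?thesis by (simp add: linear_wirtinger[OF lin[OF VD(1)[OF zV]]])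
    qed
    have "\<exists>!v. D z v = W (\<psi> z)"
      unfolding * orientation_preserving_linear_inverse[OF jac[OF zV]] by simp
    from theI'[OF this] have "D z (chart_field \<psi> W z) = W (\<psi> z)"
      by (simp add: chart_field_def D_def)
    then show "?a * chart_field \<psi> W z + ?b * cnj (chart_field \<psi> W z) = ?y"
      using * by simp
  qed (fact V(1,2) \<open>r > 0\<close> jac Y index)+
qed

text \<open>
  The inverse of the equatorial projection on the open hemisphere around a pole.
\<close>

definition hemisphere :: "real \<Rightarrow> real \<Rightarrow> complex \<Rightarrow> real ^ 3" where
  "hemisphere \<sigma> R z = vector [Re z, \<sigma> * Im z, \<sigma> * sqrt (R\<^sup>2 - (norm z)\<^sup>2)]"

lemma hemisphere_has_derivative:
  assumes "z \<in> ball 0 R"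
  shows "(hemisphere \<sigma> R has_derivative
    (\<lambda>v. vector [Re v, \<sigma> * Im v, - (\<sigma> * (z \<bullet> v) / sqrt (R\<^sup>2 - (norm z)\<^sup>2))])) (at z)"
proof -
  have "(norm z)\<^sup>2 < R\<^sup>2" using assms by (intro power_strict_mono) auto
  then have pos: "R\<^sup>2 - z \<bullet> z > 0" by (simp add: power2_norm_eq_inner)
  have "((\<lambda>z :: complex. R\<^sup>2 - z \<bullet> z) has_derivative (\<lambda>v. 0 - (z \<bullet> v + v \<bullet> z))) (at z)"
    by (intro has_derivative_diff has_derivative_const has_derivative_inner has_derivative_ident)
  from DERIV_compose_FDERIV[OF DERIV_real_sqrt[OF pos] this]
  have "((\<lambda>z :: complex. sqrt (R\<^sup>2 - z \<bullet> z)) has_derivative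
      (\<lambda>v. (0 - (z \<bullet> v + v \<bullet> z)) * (inverse (sqrt (R\<^sup>2 - z \<bullet> z)) / 2))) (at z)" .
  from has_derivative_mult_right[OF this, of \<sigma>]
  have 3: "((\<lambda>z :: complex. \<sigma> * sqrt (R\<^sup>2 - (norm z)\<^sup>2)) has_derivative
      (\<lambda>v. - (\<sigma> * (z \<bullet> v) / sqrt (R\<^sup>2 - (norm z)\<^sup>2)))) (at z)"
    by (simp add: power2_norm_eq_inner inner_commute field_simps)
  have 1: "(Re has_derivative Re) (at z)" "(Im has_derivative Im) (at z)"
    by (simp_all add: bounded_linear_imp_has_derivative bounded_linear_Re bounded_linear_Im)
  show ?thesis
    unfolding hemisphere_def[abs_def]
    by (rule has_derivative_vector3[OF 1(1) has_derivative_mult_right[OF 1(2)] 3])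
qed

text \<open>
  This chart shows that the poles are covered by oriented charts at all.
\<close>

lemma oriented_chart_hemisphere:
  assumes R: "R > 0" and \<sigma>: "\<sigma> = 1 \<or> \<sigma> = - 1"
  shows "oriented_chart R (ball 0 R) (hemisphere \<sigma> R)"
proof -
  let ?\<psi> = "hemisphere \<sigma> R"
  define D where "D = (\<lambda>z v :: complex. vector [Re v, \<sigma> * Im v, - (\<sigma> * (z \<bullet> v) / sqrt (R\<^sup>2 - (norm z)\<^sup>2))] :: real ^ 3)"
  have D: "(?\<psi> has_derivative D z) (at z)" if "z \<in> ball 0 R" for z
    unfolding D_def by (rule hemisphere_has_derivative[OF that])
  have fD: "frechet_derivative ?\<psi> (at z) = D z" if "z \<in> ball 0 R" for z
    using frechet_derivative_at[OF D[OF that]] by simp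
  have \<sigma>2: "\<sigma>\<^sup>2 = 1" "\<sigma> * \<sigma> = 1" using \<sigma> by auto
  have pos: "R\<^sup>2 - (norm z)\<^sup>2 > 0" if "z \<in> ball 0 R" for z :: complex
    using that by (simp add: power_strict_mono)
  have proj: "equator_proj \<sigma> (?\<psi> z) = z" for z
    using \<sigma>2 by (simp add: equator_proj_def hemisphere_def complex_eq_iff flip: mult.assoc)
  have cont: "continuous_on (ball 0 R) ?\<psi>"
    by (rule has_derivative_continuous_on) (use D has_derivative_at_withinI in blast)
  have third: "\<sigma> * (?\<psi> z $ 3) = sqrt (R\<^sup>2 - (norm z)\<^sup>2)" for z
    using \<sigma>2 by (simp add: hemisphere_def flip: mult.assoc)
  have sph: "?\<psi> z \<in> sphere 0 R" if "z \<in> ball 0 R" for z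
  proof -
    have "(norm (?\<psi> z))\<^sup>2 = (Re z)\<^sup>2 + (Im z)\<^sup>2 + (R\<^sup>2 - (norm z)\<^sup>2)"
      unfolding norm_vec3_squared using \<sigma>2 pos[OF that]
      by (simp add: hemisphere_def power_mult_distrib)
    then have "(norm (?\<psi> z))\<^sup>2 = R\<^sup>2" by (simp add: cmod_power2)
    then show ?thesis using R by (simp add: power2_eq_iff_nonneg)
  qed
  have img: "?\<psi> ` ball 0 R = sphere 0 R \<inter> {P. \<sigma> * P $ 3 > 0}"
  proof (intro equalityI subsetI)
    fix P assume "P \<in> ?\<psi> ` ball 0 R"
    then show "P \<in> sphere 0 R \<inter> {P. \<sigma> * P $ 3 > 0}"
      using sph third pos by auto
  next
    fix P assume P: "P \<in> sphere 0 R \<inter> {P :: real ^ 3. \<sigma> * P $ 3 > 0}"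
    define z where "z = equator_proj \<sigma> P"
    have "(norm P)\<^sup>2 = (norm z)\<^sup>2 + (P $ 3)\<^sup>2"
      unfolding norm_vec3_squared cmod_power2 z_def equator_proj_def
      using \<sigma>2 by (simp add: power_mult_distrib)
    moreover have "(P $ 3)\<^sup>2 > 0" using P by auto
    ultimately have "(norm z)\<^sup>2 < R\<^sup>2" using P by auto
    then have z: "z \<in> ball 0 R" using R by (simp add: power_less_imp_less_base)
    have "P = ?\<psi> z"
      by (rule equator_proj_eq_imp_eq_on_hemisphere[of \<sigma> _ R])
        (use \<sigma> P sph[OF z] third pos[OF z] proj z_def in auto)
    then show "P \<in> ?\<psi> ` ball 0 R" using z by blast
  qed
  show ?thesis unfolding oriented_chart_def
  proof (intro conjI ballI allI)
    show "openin (top_of_set (sphere 0 R)) (?\<psi> ` ball 0 R)"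
      unfolding img by (intro openin_open_Int open_Collect_less continuous_intros)
    have "homeomorphism (ball 0 R) (?\<psi> ` ball 0 R) ?\<psi> (equator_proj \<sigma>)"
      unfolding homeomorphism_def
      using proj cont
      by (auto simp: image_image intro!: bounded_linear.continuous_on[OF bounded_linear_equator_proj])
    then show "\<exists>\<phi>. homeomorphism (ball 0 R) (?\<psi> ` ball 0 R) ?\<psi> \<phi>"
      by blast
  next
    fix z :: complex assume z: "z \<in> ball 0 R"
    show "?\<psi> differentiable (at z)" using D[OF z] by (rule differentiableI)
    have s: "sqrt (R\<^sup>2 - (norm z)\<^sup>2) > 0" using pos[OF z] by simp
    have "cross3 (D z 1) (D z \<i>) \<bullet> ?\<psi> z =
        (\<sigma> * \<sigma>) * ((Re z)\<^sup>2 / sqrt (R\<^sup>2 - (norm z)\<^sup>2) + (Im z)\<^sup>2 / sqrt (R\<^sup>2 - (norm z)\<^sup>2) + sqrt (R\<^sup>2 - (norm z)\<^sup>2))"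
      unfolding inner_vec_def sum_3 cross_components D_def hemisphere_def
      using \<sigma> by (auto simp: power2_eq_square inner_complex_def)
    also have "\<dots> > 0" using s \<sigma>2 by (simp add: add_nonneg_pos)
    finally show "cross3 (frechet_derivative ?\<psi> (at z) 1) (frechet_derivative ?\<psi> (at z) \<i>) \<bullet> ?\<psi> z > 0"
      by (simp add: fD[OF z])
  next
    fix v :: complex
    have "continuous_on (ball 0 R) (\<lambda>z. D z v)"
      unfolding D_def continuous_on_componentwise[where 'a = complex and 'b = "real ^ 3"]
      by (auto simp: Basis_vec_def inner_axis UNIV_3 intro!: continuous_intros dest: pos)
    then show "continuous_on (ball 0 R) (\<lambda>z. frechet_derivative ?\<psi> (at z) v)"
      by (rule continuous_on_eq) (simp add: fD)
  qed simp
qed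

section \<open>The radial projection of the cylinder\<close>

lemma norm_cylinder_point:
  "norm (cylinder_point l (s, \<rho>)) = sqrt ((cyl_radius l)\<^sup>2 + \<rho>\<^sup>2)"
proof -
  have "(norm (cylinder_point l (s, \<rho>)))\<^sup>2 = (cyl_radius l)\<^sup>2 + \<rho>\<^sup>2"
    unfolding norm_vec3_squared cylinder_point_def
    by (simp add: power_mult_distrib flip: distrib_left)
  then show ?thesis by (simp add: real_sqrt_unique)
qed

lemma sphere_proj_eq:
  assumes "0 < l"
  shows "sphere_proj l (s, \<rho>) =
    (cyl_radius l / sqrt ((cyl_radius l)\<^sup>2 + \<rho>\<^sup>2)) *\<^sub>R cylinder_point l (s, \<rho>)"
proof -
  define R where "R = cyl_radius l"
  define m where "m = sqrt (R\<^sup>2 + \<rho>\<^sup>2)"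
  define C where "C = cylinder_point l (s, \<rho>)"
  have R: "R > 0" using assms by (simp add: R_def cyl_radius_def)
  have m: "m > 0" using R by (simp add: m_def add_pos_nonneg)
  have Rm: "R \<le> m" unfolding m_def by (rule real_le_rsqrt) simp
  have nC: "norm C = m" by (simp add: C_def m_def R_def norm_cylinder_point)
  show ?thesis unfolding sphere_proj_def R_def[symmetric] m_def[symmetric] C_def[symmetric]
  proof (rule the_equality)
    have "(R / m) *\<^sub>R C = (1 - (1 - R / m)) *\<^sub>R C + (1 - R / m) *\<^sub>R 0" by simp
    moreover have "0 \<le> 1 - R / m" "1 - R / m \<le> 1"
      using R m Rm by (auto simp: field_simps)
    ultimately have "(R / m) *\<^sub>R C \<in> closed_segment C 0"
      unfolding closed_segment_def by blast
    then show "(R / m) *\<^sub>R C \<in> closed_segment C 0 \<and> (R / m) *\<^sub>R C \<in> sphere 0 R"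
      using nC m R by simp
  next
    fix P assume P: "P \<in> closed_segment C 0 \<and> P \<in> sphere 0 R"
    then obtain u where u: "u \<le> 1" "P = (1 - u) *\<^sub>R C"
      by (auto simp: closed_segment_def)
    then have "(1 - u) * m = R" using P nC by simp
    then have "1 - u = R / m" using m by (simp add: field_simps)
    then show "P = (R / m) *\<^sub>R C" using u by simp
  qed
qed

lemma sphere_proj_in_sphere:
  assumes "0 < l"
  shows "sphere_proj l q \<in> sphere 0 (cyl_radius l)"
proof -
  obtain s \<rho> where q: "q = (s, \<rho>)" by fastforce
  have R: "cyl_radius l > 0" using assms by (simp add: cyl_radius_def)
  then have "sqrt ((cyl_radius l)\<^sup>2 + \<rho>\<^sup>2) > 0" by (simp add: add_pos_nonneg)
  then show ?thesis using R by (simp add: q sphere_proj_eq[OF assms] norm_cylinder_point)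
qed

lemma sphere_proj_third: 
  assumes "0 < l"
  shows "sphere_proj l (s, \<rho>) $ 3 = cyl_radius l * \<rho> / sqrt ((cyl_radius l)\<^sup>2 + \<rho>\<^sup>2)"
  unfolding sphere_proj_eq[OF assms] by (simp add: cylinder_point_def)

lemma equator_proj_sphere_proj:
  assumes "0 < l" "\<sigma> = 1 \<or> \<sigma> = - 1"
  shows "equator_proj \<sigma> (sphere_proj l (s, \<rho>)) =
    of_real ((cyl_radius l)\<^sup>2 / sqrt ((cyl_radius l)\<^sup>2 + \<rho>\<^sup>2)) * cis (\<sigma> * s / cyl_radius l)"
  unfolding sphere_proj_eq[OF assms(1)] using assms(2)
  by (auto simp: cylinder_point_def equator_proj_def complex_eq_iff power2_eq_square)

lemma sphere_proj_vector:
  assumes "0 < l"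
  shows "sphere_proj l = (\<lambda>q. let R = cyl_radius l; m = sqrt (R\<^sup>2 + (snd q)\<^sup>2) in
    vector [R / m * (R * cos (fst q / R)), R / m * (R * sin (fst q / R)), R / m * snd q])"
  by (rule ext) (auto simp: sphere_proj_eq[OF assms] cylinder_point_def vec_eq_iff forall_3 Let_def split: prod.split)

lemma has_derivative_divide_hypot:
  fixes q :: "real \<times> real"
  assumes "R > 0"
  shows "((\<lambda>q. c / sqrt (R\<^sup>2 + (snd q)\<^sup>2)) has_derivative
    (\<lambda>v. snd v * - (c * snd q / sqrt (R\<^sup>2 + (snd q)\<^sup>2) ^ 3))) (at q)"
proof (rule DERIV_compose_FDERIV[where g = snd])
  define m where "m = sqrt (R\<^sup>2 + (snd q)\<^sup>2)"
  have pos: "R\<^sup>2 + (snd q)\<^sup>2 > 0" using assms by (simp add: add_pos_nonneg)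
  then have m: "m > 0" by (simp add: m_def)
  have d: "((\<lambda>\<rho>. sqrt (R\<^sup>2 + \<rho>\<^sup>2)) has_real_derivative (snd q / m)) (at (snd q))"
  proof -
    have "((\<lambda>\<rho>. R\<^sup>2 + \<rho>\<^sup>2) has_real_derivative 2 * snd q) (at (snd q))"
      by (rule derivative_eq_intros refl | simp)+
    from DERIV_chain2[where f = sqrt, OF DERIV_real_sqrt[OF pos] this]
    have "((\<lambda>\<rho>. sqrt (R\<^sup>2 + \<rho>\<^sup>2)) has_real_derivative inverse m / 2 * (2 * snd q)) (at (snd q))"
      unfolding m_def .
    moreover have "inverse m / 2 * (2 * snd q) = snd q / m"
      using m by (simp add: field_simps)
    ultimately show ?thesis by simp
  qed
  have "((\<lambda>\<rho>. c * inverse (sqrt (R\<^sup>2 + \<rho>\<^sup>2))) has_real_derivative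
      c * - (inverse m * (snd q / m) * inverse m)) (at (snd q))"
    using DERIV_cmult[OF DERIV_inverse'[OF d m[unfolded m_def, THEN less_imp_neq, symmetric]]]
    unfolding m_def .
  moreover have "c * - (inverse m * (snd q / m) * inverse m) = - (c * snd q / m ^ 3)"
    using m by (simp add: power3_eq_cube field_simps)
  ultimately show "((\<lambda>\<rho>. c / sqrt (R\<^sup>2 + \<rho>\<^sup>2)) has_real_derivative
      - (c * snd q / sqrt (R\<^sup>2 + (snd q)\<^sup>2) ^ 3)) (at (snd q))"
    by (simp only: divide_inverse[of c] m_def)
qed (rule has_derivative_snd[OF has_derivative_ident])

lemma sphere_proj_differentiable:
  assumes "0 < l"
  shows "sphere_proj l differentiable (at q)"
proof -
  define R where "R = cyl_radius l"
  have R: "R > 0" using assms by (simp add: R_def cyl_radius_def)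
  define f where "f = (\<lambda>q :: real \<times> real. R / sqrt (R\<^sup>2 + (snd q)\<^sup>2))"
  obtain f' where f': "(f has_derivative f') (at q)"
    unfolding f_def using has_derivative_divide_hypot[OF R] by meson
  have "bounded_linear (\<lambda>q :: real \<times> real. fst q / R)"
    by (rule bounded_linear_compose[OF bounded_linear_divide bounded_linear_fst])
  then have h: "((\<lambda>q :: real \<times> real. fst q / R) has_derivative (\<lambda>v. fst v / R)) (at q)"
    by (rule bounded_linear_imp_has_derivative)
  note fR = has_derivative_mult[OF f' has_derivative_mult[OF has_derivative_const[of R]]]
  have "sphere_proj l = (\<lambda>q. vector [f q * (R * cos (fst q / R)), f q * (R * sin (fst q / R)), f q * snd q])"
    unfolding sphere_proj_vector[OF assms] f_def Let_def R_def ..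
  moreover note has_derivative_vector3[OF fR[OF DERIV_compose_FDERIV[OF DERIV_cos h]]
        fR[OF DERIV_compose_FDERIV[OF DERIV_sin h]]
        has_derivative_mult[OF f' has_derivative_snd[OF has_derivative_ident]]]
  ultimately show ?thesis by (simp only: differentiableI)
qed

text \<open>
  In the equatorial plane the eastward unit vector is \<open>\<sigma> i cis (\<sigma> s / R)\<close>. The factor \<open>R / m\<close> is the
  cosine of the latitude; in the second component it enters squared, together with \<open>\<sigma> \<rho> / m\<close>, the
  absolute sine of the latitude if \<open>\<sigma> \<rho> > 0\<close>, as foreshortening of the northward unit vector.
\<close>

lemma equator_proj_derivative_sphere_proj:
  fixes l \<sigma> s \<rho> a b :: real
  assumes "0 < l" "\<sigma> = 1 \<or> \<sigma> = - 1"
  defines "R \<equiv> cyl_radius l" and "m \<equiv> sqrt ((cyl_radius l)\<^sup>2 + \<rho>\<^sup>2)"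
  shows "equator_proj \<sigma> (frechet_derivative (sphere_proj l) (at (s, \<rho>)) (a, b)) =
    \<sigma> * \<i> * cis (\<sigma> * s / R) * Complex (R / m * a) (\<sigma> * R\<^sup>2 * \<rho> / m ^ 3 * b)"
proof -
  have R: "R > 0" using assms by (simp add: R_def cyl_radius_def)
  have pos: "R\<^sup>2 + \<rho>\<^sup>2 > 0" using R by (simp add: add_pos_nonneg)
  have m: "m > 0" "m\<^sup>2 = R\<^sup>2 + \<rho>\<^sup>2" using pos by (auto simp: m_def R_def[symmetric])
  have \<sigma>: "\<sigma> * \<sigma> = 1" using assms(2) by auto
  define D where "D = frechet_derivative (sphere_proj l) (at (s, \<rho>))"
  define e where "e = cis (\<sigma> * s / R)"
  have "(sphere_proj l has_derivative D) (at (s, \<rho>))"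
    unfolding D_def using sphere_proj_differentiable[OF assms(1)] frechet_derivative_works by blast
  then have 1: "((\<lambda>q. equator_proj \<sigma> (sphere_proj l q)) has_derivative (\<lambda>v. equator_proj \<sigma> (D v))) (at (s, \<rho>))"
    by (rule bounded_linear.has_derivative[OF bounded_linear_equator_proj])
  have 2: "(\<lambda>q. equator_proj \<sigma> (sphere_proj l q)) =
      (\<lambda>q. (R\<^sup>2 / sqrt (R\<^sup>2 + (snd q)\<^sup>2)) *\<^sub>R exp (\<i> * of_real (\<sigma> * fst q / R)))"
    by (rule ext) (auto simp: equator_proj_sphere_proj[OF assms(1,2)] R_def cis_conv_exp scaleR_conv_of_real split: prod.split)
  have 3: "((\<lambda>q. R\<^sup>2 / sqrt (R\<^sup>2 + (snd q)\<^sup>2)) has_derivative (\<lambda>v. snd v * - (R\<^sup>2 * \<rho> / m ^ 3))) (at (s, \<rho>))"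
    using has_derivative_divide_hypot[OF R, of "R\<^sup>2" "(s, \<rho>)"] by (simp add: m_def R_def)
  have 4: "((\<lambda>q. exp (\<i> * of_real (\<sigma> * fst q / R))) has_derivative
      (\<lambda>v. \<i> * of_real (\<sigma> * fst v / R) * e)) (at (s, \<rho>))"
  proof -
    have "linear (\<lambda>q :: real \<times> real. \<i> * of_real (\<sigma> * fst q / R))"
      by (rule linearI) (simp_all add: scaleR_conv_of_real add_divide_distrib distrib_left)
    then have "((\<lambda>q :: real \<times> real. \<i> * of_real (\<sigma> * fst q / R)) has_derivative
        (\<lambda>v. \<i> * of_real (\<sigma> * fst v / R))) (at (s, \<rho>))"
      by (simp add: bounded_linear_imp_has_derivative linear_conv_bounded_linear)
    from has_derivative_compose[OF this DERIV_exp[unfolded has_field_derivative_def]]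
    show ?thesis by (simp add: e_def cis_conv_exp mult.commute)
  qed
  have 5: "((\<lambda>q. equator_proj \<sigma> (sphere_proj l q)) has_derivative
     (\<lambda>v. (R\<^sup>2 / m) *\<^sub>R (\<i> * of_real (\<sigma> * fst v / R) * e) +
        (snd v * - (R\<^sup>2 * \<rho> / m ^ 3)) *\<^sub>R e)) (at (s, \<rho>))"
    unfolding 2 using has_derivative_scaleR[OF 3 4]
    by (simp add: m_def R_def e_def cis_conv_exp)
  have "equator_proj \<sigma> (D (a, b)) = (R\<^sup>2 / m) *\<^sub>R (\<i> * of_real (\<sigma> * a / R) * e) +
        (b * - (R\<^sup>2 * \<rho> / m ^ 3)) *\<^sub>R e"
    using fun_cong[OF has_derivative_unique[OF 1 5], of "(a, b)"] by simp
  also have "\<dots> = \<sigma> * \<i> * e * Complex (R / m * a) (\<sigma> * R\<^sup>2 * \<rho> / m ^ 3 * b)"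
    using R \<sigma> by (auto simp: complex_eq_iff power2_eq_square algebra_simps)
  finally show ?thesis by (simp add: D_def e_def)
qed

lemma sphere_proj_periodic:
  assumes "0 < l"
  shows "sphere_proj l (s + of_int n * l, \<rho>) = sphere_proj l (s, \<rho>)"
proof -
  have "(s + l) / cyl_radius l = s / cyl_radius l + 2 * pi" for s
    using assms by (simp add: cyl_radius_def field_simps)
  then have "sphere_proj l (s + l, \<rho>) = sphere_proj l (s, \<rho>)" for s
    unfolding sphere_proj_eq[OF assms] cylinder_point_def by simp
  then show ?thesis by (rule periodic_of_int[where f = "\<lambda>s. sphere_proj l (s, \<rho>)"])
qed

lemma sphere_proj_eq_imp:
  assumes l: "0 < l" and eq: "sphere_proj l (s, \<rho>) = sphere_proj l (s', \<rho>')"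
  obtains n :: int where "s' = s + of_int n * l" "\<rho>' = \<rho>"
proof -
  define R where "R = cyl_radius l"
  have R: "R > 0" using l by (simp add: R_def cyl_radius_def)
  have m: "sqrt (R\<^sup>2 + x\<^sup>2) > 0" for x using R by (simp add: add_pos_nonneg)
  have e: "of_real (R\<^sup>2 / sqrt (R\<^sup>2 + \<rho>\<^sup>2)) * cis (s / R) = of_real (R\<^sup>2 / sqrt (R\<^sup>2 + \<rho>'\<^sup>2)) * cis (s' / R)"
    using arg_cong[OF eq, of "equator_proj 1"] equator_proj_sphere_proj[OF l, of 1] by (simp add: R_def)
  from arg_cong[OF this, of norm] have "R\<^sup>2 / sqrt (R\<^sup>2 + \<rho>\<^sup>2) = R\<^sup>2 / sqrt (R\<^sup>2 + \<rho>'\<^sup>2)"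
    using m[of \<rho>] m[of \<rho>'] by (simp add: norm_mult norm_divide)
  then have mm: "sqrt (R\<^sup>2 + \<rho>\<^sup>2) = sqrt (R\<^sup>2 + \<rho>'\<^sup>2)"
    using R m[of \<rho>] m[of \<rho>'] by (simp add: frac_eq_eq)
  have "R * \<rho> / sqrt (R\<^sup>2 + \<rho>\<^sup>2) = R * \<rho>' / sqrt (R\<^sup>2 + \<rho>'\<^sup>2)"
    using arg_cong[OF eq, of "\<lambda>P :: real ^ 3. P $ 3"] by (simp only: sphere_proj_third[OF l] R_def)
  then have "\<rho>' = \<rho>" using mm R m[of \<rho>'] by simp
  moreover have "cis (s / R) = cis (s' / R)"
    using e mm R m[of \<rho>'] by simp
  then have "exp (\<i> * of_real (s' / R)) = exp (\<i> * of_real (s / R))"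
    by (simp add: cis_conv_exp)
  then obtain n :: int where "\<i> * of_real (s' / R) = \<i> * of_real (s / R) + of_real (of_int (2 * n) * pi) * \<i>"
    unfolding exp_eq by blast
  from arg_cong[OF this, of Im] have "s' / R = s / R + of_int n * (2 * pi)" by simp
  then have "s' = s + of_int n * (2 * pi * R)" using R by (simp add: field_simps)
  then have "s' = s + of_int n * l" by (simp add: R_def cyl_radius_def)
  ultimately show ?thesis using that by blast
qed

text \<open>
  The push-forward is defined through the preimage in a fundamental domain; for a periodic field any
  other preimage gives the same vector.
\<close>

lemma push_to_sphere_sphere_proj:
  assumes l: "0 < l" and G: "\<And>s \<rho>. G (s + l, \<rho>) = G (s, \<rho>)"
  shows "push_to_sphere l G (sphere_proj l (s, \<rho>)) =
    frechet_derivative (sphere_proj l) (at (s, \<rho>)) (Re (G (s, \<rho>)), Im (G (s, \<rho>)))"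
proof -
  define q where "q = inv_into ({0..<l} \<times> UNIV) (sphere_proj l) (sphere_proj l (s, \<rho>))"
  define k where "k = \<lfloor>s / l\<rfloor>"
  have "of_int k \<le> s / l" "s / l < of_int k + 1" unfolding k_def by linarith+
  then have "0 \<le> s + of_int (- k) * l" "s + of_int (- k) * l < l"
    using l by (auto simp: field_simps)
  then have "sphere_proj l (s, \<rho>) \<in> sphere_proj l ` ({0..<l} \<times> UNIV)"
    using sphere_proj_periodic[OF l, of s "- k" \<rho>]
    by (intro image_eqI[of _ _ "(s + of_int (- k) * l, \<rho>)"]) auto
  from f_inv_into_f[OF this] have "sphere_proj l (s, \<rho>) = sphere_proj l (fst q, snd q)"
    unfolding q_def prod.collapse by (rule sym)
  then obtain n :: int where n: "fst q = s + of_int n * l" "snd q = \<rho>"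
    by (rule sphere_proj_eq_imp[OF l])
  \<comment> \<open>The chosen preimage is \<open>(s, \<rho>)\<close> moved by a period vector, under which both the projection and
    \<open>G\<close> are invariant.\<close>
  define w where "w = (of_int n * l, 0 :: real)"
  have q: "q = (s, \<rho>) + w" using n by (simp add: prod_eq_iff w_def)
  have Gq: "G q = G (s, \<rho>)"
  proof -
    have "G (s + of_int n * l, \<rho>) = G (s, \<rho>)"
      by (rule periodic_of_int[where f = "\<lambda>s. G (s, \<rho>)"]) (rule G)
    then show ?thesis by (simp add: q w_def)
  qed
  define D where "D = frechet_derivative (sphere_proj l) (at q)"
  have "(sphere_proj l has_derivative D) (at ((s, \<rho>) + w))"
    unfolding q[symmetric] D_def
    using sphere_proj_differentiable[OF l] frechet_derivative_works by blast
  from has_derivative_compose[OF has_derivative_add_const[OF has_derivative_ident] this]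
  have "((\<lambda>x. sphere_proj l (x + w)) has_derivative D) (at (s, \<rho>))" .
  moreover have "(\<lambda>x. sphere_proj l (x + w)) = sphere_proj l"
    using sphere_proj_periodic[OF l] by (auto simp: w_def)
  ultimately have "D = frechet_derivative (sphere_proj l) (at (s, \<rho>))"
    by (simp only: frechet_derivative_at)
  then show ?thesis
    unfolding push_to_sphere_def q_def[symmetric] Let_def Gq D_def by simp
qed

section \<open>The projected field in the equatorial plane\<close>

text \<open>
  The value of \<open>G\<close> at the cylinder point that lies over the point of the \<open>\<sigma>\<close>-hemisphere with equatorial
  projection \<open>w\<close>.
\<close>

definition field_over :: "real \<Rightarrow> real \<Rightarrow> (real \<times> real \<Rightarrow> complex) \<Rightarrow> complex \<Rightarrow> complex" where
  "field_over \<sigma> R G w = G (R * (\<sigma> * Arg w), \<sigma> * (R * sqrt (R\<^sup>2 - (norm w)\<^sup>2) / norm w))"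

text \<open>
  The components of the projected field in the orthonormal frame of the plane that starts with the
  eastward vector. The two factors are \<open>cos \<lambda>\<close> and \<open>cos\<^sup>2 \<lambda> \<bar>sin \<lambda>\<bar>\<close> for the latitude \<open>\<lambda>\<close>; the sine comes
  from the foreshortening of the northward vector.
\<close>

definition frame_components :: "real \<Rightarrow> real \<Rightarrow> (real \<times> real \<Rightarrow> complex) \<Rightarrow> complex \<Rightarrow> complex" where
  "frame_components \<sigma> R G w = Complex (norm w / R * Re (field_over \<sigma> R G w))
     ((norm w)\<^sup>2 * sqrt (R\<^sup>2 - (norm w)\<^sup>2) / R ^ 3 * Im (field_over \<sigma> R G w))"

definition projected_field :: "real \<Rightarrow> real \<Rightarrow> (real \<times> real \<Rightarrow> complex) \<Rightarrow> complex \<Rightarrow> complex" where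
  "projected_field \<sigma> R G w = of_real \<sigma> * \<i> * sgn w * frame_components \<sigma> R G w"

text \<open>
  Identifies the field that represents the push-forward in the equatorial plane; tangency is what lets
  the planar field determine the spatial one.
\<close>

lemma push_to_sphere_projected_field:
  fixes P :: "real ^ 3"
  assumes l: "0 < l" and \<sigma>: "\<sigma> = 1 \<or> \<sigma> = - 1"
    and G: "\<And>s \<rho>. G (s + l, \<rho>) = G (s, \<rho>)"
    and R: "R = cyl_radius l"
    and P: "P \<in> sphere 0 R" "\<sigma> * P $ 3 > 0" "equator_proj \<sigma> P \<in> ball 0 R - {0}"
  shows "push_to_sphere l G P \<bullet> P = 0 \<and>
    equator_proj \<sigma> (push_to_sphere l G P) = projected_field \<sigma> R G (equator_proj \<sigma> P)"
proof -
  define w where "w = equator_proj \<sigma> P"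
  define r where "r = norm w"
  define h where "h = sqrt (R\<^sup>2 - r\<^sup>2)"
  define s where "s = R * (\<sigma> * Arg w)"
  define \<rho> where "\<rho> = \<sigma> * (R * h / r)"
  define m where "m = sqrt (R\<^sup>2 + \<rho>\<^sup>2)"
  have Rpos: "R > 0" using l by (simp add: R cyl_radius_def)
  have \<sigma>2: "\<sigma>\<^sup>2 = 1" "\<sigma> * \<sigma> = 1" using \<sigma> by auto
  have r: "0 < r" "r < R" "w \<noteq> 0" using P(3) by (auto simp: r_def w_def)
  have "r\<^sup>2 < R\<^sup>2" using r by (simp add: power_strict_mono)
  then have h: "h > 0" "h\<^sup>2 = R\<^sup>2 - r\<^sup>2" by (simp_all add: h_def)
  \<comment> \<open>Similar triangles: \<open>r / R\<close> and \<open>R / m\<close> are both the cosine of the latitude of \<open>P\<close>.\<close>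
  have m: "m = R\<^sup>2 / r"
  proof -
    have "R\<^sup>2 + \<rho>\<^sup>2 = (R\<^sup>2 / r)\<^sup>2"
    proof -
      have "R\<^sup>2 + \<rho>\<^sup>2 = R\<^sup>2 * (r\<^sup>2 + h\<^sup>2) / r\<^sup>2"
        using r \<sigma>2 unfolding \<rho>_def power_mult_distrib power_divide by (simp add: field_simps)
      also have "r\<^sup>2 + h\<^sup>2 = R\<^sup>2" using h(2) by simp
      finally show ?thesis by (simp add: power_divide power2_eq_square)
    qed
    then show ?thesis using r Rpos unfolding m_def by (simp add: real_sqrt_unique)
  qed
  have cis: "cis (\<sigma> * s / R) = sgn w"
    using Rpos \<sigma>2 r(3) by (simp add: s_def cis_Arg flip: mult.assoc)
  have third: "sphere_proj l (s, \<rho>) $ 3 = \<sigma> * h"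
    unfolding sphere_proj_third[OF l] R[symmetric] m_def[symmetric] m
    using r Rpos by (simp add: \<rho>_def power2_eq_square)
  have eqP: "P = sphere_proj l (s, \<rho>)"
  proof (rule equator_proj_eq_imp_eq_on_hemisphere[of \<sigma> _ R])
    show "\<sigma> \<noteq> 0" using \<sigma> by auto
    show "sphere_proj l (s, \<rho>) \<in> sphere 0 R" unfolding R by (rule sphere_proj_in_sphere[OF l])
    show "0 < \<sigma> * sphere_proj l (s, \<rho>) $ 3"
      unfolding third using h \<sigma>2 by (simp flip: mult.assoc)
    show "equator_proj \<sigma> P = equator_proj \<sigma> (sphere_proj l (s, \<rho>))"
      unfolding equator_proj_sphere_proj[OF l \<sigma>] R[symmetric] m_def[symmetric] cis m
      using r Rpos by (simp add: w_def[symmetric] r_def sgn_eq)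
  qed fact+
  have push: "push_to_sphere l G P = frechet_derivative (sphere_proj l) (at (s, \<rho>)) (Re (G (s, \<rho>)), Im (G (s, \<rho>)))"
    unfolding eqP by (rule push_to_sphere_sphere_proj[OF l G])
  have tang: "push_to_sphere l G P \<bullet> P = 0"
    unfolding push unfolding eqP
    by (rule frechet_derivative_sphere_tangent[where S = UNIV and R = R])
      (use sphere_proj_differentiable[OF l] sphere_proj_in_sphere[OF l] in \<open>auto simp: R\<close>)
  have base: "field_over \<sigma> R G w = G (s, \<rho>)"
    by (simp add: field_over_def s_def \<rho>_def h_def r_def)
  have Rm: "R / m = r / R" "\<sigma> * R\<^sup>2 * \<rho> / m ^ 3 = r\<^sup>2 * h / R ^ 3"
  proof -
    show "R / m = r / R" using r Rpos by (simp add: m power2_eq_square)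
    have "\<sigma> * R\<^sup>2 * \<rho> = (\<sigma> * \<sigma>) * R ^ 3 * h / r"
      by (simp add: \<rho>_def power2_eq_square power3_eq_cube)
    then show "\<sigma> * R\<^sup>2 * \<rho> / m ^ 3 = r\<^sup>2 * h / R ^ 3"
      using r Rpos \<sigma>2 by (simp add: m power_divide power2_eq_square power3_eq_cube mult.assoc mult.commute mult.left_commute)
  qed
  have "equator_proj \<sigma> (push_to_sphere l G P) = projected_field \<sigma> R G w"
    unfolding push equator_proj_derivative_sphere_proj[OF l \<sigma>] R[symmetric] m_def[symmetric] cis Rm
    by (simp add: projected_field_def frame_components_def base r_def h_def)
  then show ?thesis using tang by (simp add: w_def)
qed

section \<open>Closed curves parametrized by arc length\<close>

lemma tangent_vec_periodic:
  assumes "\<And>s. \<alpha> differentiable (at s)" "\<And>s. \<alpha> (s + l) = \<alpha> s"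
  shows "tangent_vec \<alpha> (s + l) = tangent_vec \<alpha> s"
proof -
  have "(\<alpha> has_vector_derivative tangent_vec \<alpha> (s + l)) (at (s + l))"
    using assms(1) by (simp add: tangent_vec_def vector_derivative_works)
  then have "((\<lambda>x. \<alpha> (x + l)) has_vector_derivative tangent_vec \<alpha> (s + l)) (at s)"
    unfolding has_vector_derivative_def
    using has_derivative_compose[OF has_derivative_add_const[OF has_derivative_ident]] by blast
  then show ?thesis
    unfolding tangent_vec_def assms(2) using vector_derivative_at by metis
qed

lemma closed_arclength_curveD:
  assumes "closed_arclength_curve l \<alpha>"
  shows "0 < l" "continuous_on UNIV \<alpha>" "\<alpha> (s + l) = \<alpha> s"
    "continuous_on UNIV (tangent_vec \<alpha>)" "tangent_vec \<alpha> (s + l) = tangent_vec \<alpha> s"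
    "norm (tangent_vec \<alpha> s) = 1"
proof -
  show "0 < l" and per: "\<alpha> (s + l) = \<alpha> s" and "norm (tangent_vec \<alpha> s) = 1" for s
    using assms by (auto simp: closed_arclength_curve_def tangent_vec_def)
  obtain D where D: "D 0 = \<alpha>" "\<And>n s. (D n has_vector_derivative D (Suc n) s) (at s)"
    using assms by (auto simp: closed_arclength_curve_def smooth_curve_def)
  have D_cont: "continuous_on UNIV (D n)" for n
    by (rule continuous_at_imp_continuous_on) (use D(2) has_vector_derivative_continuous in blast)
  have "tangent_vec \<alpha> = D 1"
    using vector_derivative_at[OF D(2)[of 0]] D(1) by (auto simp: tangent_vec_def)
  then show "continuous_on UNIV (tangent_vec \<alpha>)" using D_cont by simp
  show "continuous_on UNIV \<alpha>" using D_cont[of 0] D(1) by simp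
  show "tangent_vec \<alpha> (s + l) = tangent_vec \<alpha> s"
    by (rule tangent_vec_periodic) (use D(1) D(2)[of 0] per in \<open>auto intro: differentiableI_vector\<close>)
qed

lemma tangent_vec_nonzero: "closed_arclength_curve l \<alpha> \<Longrightarrow> tangent_vec \<alpha> s \<noteq> 0"
  using closed_arclength_curveD(6)[of l \<alpha> s] by auto

lemma winding_number_tangent_vec:
  assumes "closed_arclength_curve l \<alpha>"
  shows "winding_number (\<lambda>u. tangent_vec \<alpha> (l * u)) 0 = of_int (rotation_index l \<alpha>)"
proof -
  note curve = closed_arclength_curveD[OF assms]
  define p where "p = (\<lambda>u. tangent_vec \<alpha> (l * u))"
  have "path p" unfolding p_def path_def
    by (rule continuous_on_compose2[OF curve(4)]) (auto intro!: continuous_intros)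
  moreover have "0 \<notin> path_image p"
    using tangent_vec_nonzero[OF assms] by (simp add: p_def path_image_def image_iff)
  moreover have "pathfinish p = pathstart p"
    using curve(5)[of 0] by (simp add: p_def pathfinish_def pathstart_def)
  ultimately obtain d :: int where d: "winding_number p 0 = of_int d"
    using integer_winding_number Ints_cases by metis
  then have "rotation_index l \<alpha> = d"
    unfolding rotation_index_def circle_degree_def by (simp add: p_def curve(6))
  then show ?thesis using d by (simp add: p_def)
qed

text \<open>
  The cylinder height over a point of the sphere at distance \<open>r\<close> from the axis decreases in \<open>r\<close> and takes
  the value \<open>M\<close> at the stated bound.
\<close>

lemma height_over_small_disc:
  assumes "R > 0" "M > 0" "0 < r" "r < R\<^sup>2 / sqrt (R\<^sup>2 + M\<^sup>2)"
  shows "M < R * sqrt (R\<^sup>2 - r\<^sup>2) / r"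
proof -
  have pos: "R\<^sup>2 + M\<^sup>2 > 0" using assms(1) by (simp add: add_pos_nonneg)
  have "r * sqrt (R\<^sup>2 + M\<^sup>2) < R\<^sup>2"
    using assms(4) pos by (simp add: pos_less_divide_eq)
  then have "(r * sqrt (R\<^sup>2 + M\<^sup>2))\<^sup>2 < (R\<^sup>2)\<^sup>2"
    using assms(3) pos by (intro power_strict_mono) auto
  then have "r\<^sup>2 * (R\<^sup>2 + M\<^sup>2) < R\<^sup>2 * R\<^sup>2"
    unfolding power_mult_distrib real_sqrt_pow2[OF less_imp_le[OF pos]]
    by (simp only: power2_eq_square[of "R\<^sup>2"])
  then have "(M * r)\<^sup>2 < R\<^sup>2 * (R\<^sup>2 - r\<^sup>2)"
    by (simp add: power_mult_distrib algebra_simps)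
  then have "M * r < sqrt (R\<^sup>2 * (R\<^sup>2 - r\<^sup>2))" by (rule real_less_rsqrt)
  also have "\<dots> = R * sqrt (R\<^sup>2 - r\<^sup>2)"
    using assms(1) by (simp add: real_sqrt_mult)
  finally show ?thesis using assms(3) by (simp add: pos_less_divide_eq)
qed

lemma ex_radius_normal_dominates:
  assumes "closed_arclength_curve l \<alpha>"
  defines "R \<equiv> cyl_radius l"
  obtains r\<^sub>0 where "0 < r\<^sub>0" "r\<^sub>0 \<le> R"
    "\<And>s r. 0 < r \<Longrightarrow> r < r\<^sub>0 \<Longrightarrow> norm (\<alpha> s) < R * sqrt (R\<^sup>2 - r\<^sup>2) / r"
proof -
  note curve = closed_arclength_curveD[OF assms(1)]
  obtain M where M: "M > 0" "\<And>s. norm (\<alpha> s) \<le> M"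
    using bounded_continuous_periodic[OF curve(1,2,3)] by blast
  have R: "R > 0" using curve(1) by (simp add: R_def cyl_radius_def)
  define r\<^sub>0 where "r\<^sub>0 = R\<^sup>2 / sqrt (R\<^sup>2 + M\<^sup>2)"
  have "R \<le> sqrt (R\<^sup>2 + M\<^sup>2)" by (rule real_le_rsqrt) simp
  then have "r\<^sub>0 > 0" "r\<^sub>0 \<le> R"
    using R by (auto simp: r\<^sub>0_def add_pos_nonneg divide_le_eq power2_eq_square)
  moreover have "norm (\<alpha> s) < R * sqrt (R\<^sup>2 - r\<^sup>2) / r" if "0 < r" "r < r\<^sub>0" for s r
    using height_over_small_disc[OF R M(1) that(1) that(2)[unfolded r\<^sub>0_def]] M(2)[of s] by linarith
  ultimately show ?thesis using that by blast
qed

section \<open>The normal map near a pole\<close>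

text \<open>
  On the disc of radius \<open>r\<^sub>0\<close> around the pole the summand \<open>\<rho> n\<close> of the normal map is longer than \<open>\<alpha>\<close>.
\<close>

locale normal_map_near_pole =
  fixes l \<sigma> r\<^sub>0 :: real and \<alpha> :: "real \<Rightarrow> complex"
  assumes curve: "closed_arclength_curve l \<alpha>" and \<sigma>: "\<sigma> = 1 \<or> \<sigma> = - 1"
    and r\<^sub>0: "0 < r\<^sub>0" "r\<^sub>0 \<le> cyl_radius l"
    and dominates: "\<And>s r. 0 < r \<Longrightarrow> r < r\<^sub>0 \<Longrightarrow>
      norm (\<alpha> s) < cyl_radius l * sqrt ((cyl_radius l)\<^sup>2 - r\<^sup>2) / r"
begin

abbreviation "R \<equiv> cyl_radius l"

abbreviation "T \<equiv> tangent_vec \<alpha>"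

abbreviation "G \<equiv> normal_map \<alpha>"

abbreviation "B \<equiv> ball 0 r\<^sub>0 - {0 :: complex}"

lemmas l = closed_arclength_curveD(1)[OF curve]
  and \<alpha> = closed_arclength_curveD(2,3)[OF curve]
  and T = closed_arclength_curveD(4,5,6)[OF curve]
  and T_nonzero = tangent_vec_nonzero[OF curve]

lemma R_pos: "R > 0" using l by (simp add: cyl_radius_def)

lemma periodic:
  assumes "\<And>s. f (s + l) = f s"
  shows "f (s + \<sigma> * l) = f s" "f (R * (\<sigma> * (x + 2 * pi))) = f (R * (\<sigma> * x))"
proof -
  show *: "f (s + \<sigma> * l) = f s" for s
    using \<sigma> assms[of s] assms[of "s - l"] by auto
  have "R * (\<sigma> * (x + 2 * pi)) = R * (\<sigma> * x) + \<sigma> * l"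
    by (simp add: cyl_radius_def field_simps)
  then show "f (R * (\<sigma> * (x + 2 * pi))) = f (R * (\<sigma> * x))" using * by simp
qed

text \<open>
  Near the pole the normal map looks like its dominating summand \<open>\<rho> n\<close>, where \<open>\<rho>\<close> has the sign of \<open>\<sigma>\<close>.
\<close>

lemma field_over_acute:
  assumes "w \<in> B"
  shows "Re (cnj (of_real \<sigma> * \<i> * T (R * (\<sigma> * Arg w))) * field_over \<sigma> R G w) > 0"
proof -
  define s where "s = R * (\<sigma> * Arg w)"
  define c where "c = R * sqrt (R\<^sup>2 - (norm w)\<^sup>2) / norm w"
  have c: "c > norm (\<alpha> s)" using assms dominates[of "norm w" s] by (auto simp: c_def)
  define N where "N = of_real \<sigma> * \<i> * T s"
  have N: "norm N = 1" using \<sigma> T(3)[of s] by (auto simp: N_def norm_mult)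
  have "field_over \<sigma> R G w = \<alpha> s + c *\<^sub>R N"
    by (simp add: field_over_def normal_map_def normal_vec_def s_def c_def N_def scaleR_conv_of_real algebra_simps)
  then have "Re (cnj N * field_over \<sigma> R G w) = Re (cnj N * \<alpha> s) + c * Re (cnj N * N)"
    by (simp add: algebra_simps)
  also have "Re (cnj N * N) = 1"
    using N complex_norm_square[of N] by (simp add: mult.commute)
  finally have "Re (cnj N * field_over \<sigma> R G w) = Re (cnj N * \<alpha> s) + c" by simp
  moreover have "\<bar>Re (cnj N * \<alpha> s)\<bar> \<le> norm (\<alpha> s)"
    using abs_Re_le_cmod[of "cnj N * \<alpha> s"] N by (simp add: norm_mult)
  ultimately show ?thesis using c by (simp add: N_def s_def)
qed

lemma field_over_nonzero: "w \<in> B \<Longrightarrow> field_over \<sigma> R G w \<noteq> 0"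
  using field_over_acute by fastforce

text \<open>
  A diagonal matrix with positive entries is positive definite.
\<close>

lemma frame_components_acute:
  assumes "w \<in> B"
  shows "Re (cnj (field_over \<sigma> R G w) * frame_components \<sigma> R G w) > 0"
proof -
  define F where "F = field_over \<sigma> R G w"
  have "norm w < R" "norm w > 0" using assms r\<^sub>0(2) by auto
  then have "(norm w)\<^sup>2 < R\<^sup>2" by (simp add: power_strict_mono)
  moreover define p where "p = norm w / R"
  moreover define q where "q = (norm w)\<^sup>2 * sqrt (R\<^sup>2 - (norm w)\<^sup>2) / R ^ 3"
  ultimately have pq: "p > 0" "q > 0"
    using R_pos \<open>norm w > 0\<close> by auto
  have "Re (cnj F * frame_components \<sigma> R G w) = p * (Re F)\<^sup>2 + q * (Im F)\<^sup>2"
  proof -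
    have "frame_components \<sigma> R G w = Complex (p * Re F) (q * Im F)"
      by (simp add: frame_components_def F_def p_def q_def)
    then show ?thesis by (simp add: power2_eq_square algebra_simps)
  qed
  moreover have "F \<noteq> 0" using field_over_nonzero[OF assms] by (simp add: F_def)
  then have "Re F \<noteq> 0 \<or> Im F \<noteq> 0" by (simp add: complex_eq_iff)
  then have "p * (Re F)\<^sup>2 + q * (Im F)\<^sup>2 > 0"
  proof
    assume "Re F \<noteq> 0"
    then show ?thesis using pq by (intro add_pos_nonneg) auto
  next
    assume "Im F \<noteq> 0"
    then show ?thesis using pq by (intro add_nonneg_pos) auto
  qed
  ultimately show ?thesis by (simp add: F_def)
qed

lemma projected_field_nonzero: "w \<in> B \<Longrightarrow> projected_field \<sigma> R G w \<noteq> 0"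
  using frame_components_acute[of w] \<sigma> by (auto simp: projected_field_def sgn_zero_iff)

lemma continuous_projected_field:
  "continuous_on B (\<lambda>w. T (R * (\<sigma> * Arg w)))"
  "continuous_on B (field_over \<sigma> R G)"
  "continuous_on B (frame_components \<sigma> R G)"
  "continuous_on B (projected_field \<sigma> R G)"
proof -
  have Arg: "continuous_on B (\<lambda>w. f (R * (\<sigma> * Arg w)))"
    if "continuous_on UNIV f" "\<And>s. f (s + l) = f s" for f :: "real \<Rightarrow> complex"
  proof (rule continuous_on_subset[OF continuous_on_periodic_Arg[where f = "\<lambda>x. f (R * (\<sigma> * x))"]])
    show "continuous_on UNIV (\<lambda>x. f (R * (\<sigma> * x)))"
      by (rule continuous_on_compose2[OF that(1)]) (auto intro!: continuous_intros)
  qed (use periodic(2)[of f, OF that(2)] in auto)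
  show 1: "continuous_on B (\<lambda>w. T (R * (\<sigma> * Arg w)))"
    by (rule Arg[OF T(1,2)])
  show 2: "continuous_on B (field_over \<sigma> R G)"
    unfolding field_over_def[abs_def] normal_map_def normal_vec_def prod.case
    by (intro continuous_intros Arg[OF \<alpha>(1,2)] 1) auto
  show 3: "continuous_on B (frame_components \<sigma> R G)"
    unfolding frame_components_def[abs_def] Complex_eq
    using R_pos by (intro continuous_intros 2) auto
  show "continuous_on B (projected_field \<sigma> R G)"
    unfolding projected_field_def[abs_def]
    by (intro continuous_intros 3) auto
qed

text \<open>
  In the south, a positively oriented loop around the pole traverses the curve backwards.
\<close>

lemma winding_number_tangent_oriented:
  "winding_number (\<lambda>u. T (\<sigma> * l * u)) 0 = of_real \<sigma> * of_int (rotation_index l \<alpha>)"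
proof (cases "\<sigma> = 1")
  case True
  then show ?thesis using winding_number_tangent_vec[OF curve] by simp
next
  case False
  then have \<sigma>1: "\<sigma> = - 1" using \<sigma> by simp
  define p where "p = (\<lambda>u. T (l * u))"
  have "path p" unfolding p_def path_def
    by (rule continuous_on_compose2[OF T(1)]) (auto intro!: continuous_intros)
  moreover have "0 \<notin> path_image p"
    using T_nonzero by (simp add: path_image_def p_def image_iff)
  ultimately have "winding_number (reversepath p) 0 = - of_int (rotation_index l \<alpha>)"
    using winding_number_reversepath winding_number_tangent_vec[OF curve] p_def by metis
  moreover have "reversepath p = (\<lambda>u. T (\<sigma> * l * u))"
    using T(2)[of "- (l * u)" for u] by (auto simp: reversepath_def p_def \<sigma>1 algebra_simps)
  ultimately show ?thesis by (simp add: \<sigma>1)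
qed

text \<open>
  The turns of the frame and of the components add up. For the components, the two acute angle lemmas
  lead back to the tangent, evaluated along a continuous lift of the longitude of \<open>c\<close>; over one turn of
  \<open>c\<close> the arc length increases by \<open>\<sigma> l\<close>.
\<close>

lemma projected_field_index:
  assumes c: "path c" "pathfinish c = pathstart c" "path_image c \<subseteq> B" "winding_number c 0 = 1"
  shows "winding_number (projected_field \<sigma> R G \<circ> c) 0 = 1 + of_real \<sigma> * of_int (rotation_index l \<alpha>)"
proof -
  have cB: "c t \<in> B" if "t \<in> {0..1}" for t
    using c(3) that unfolding path_image_def by blast
  have c0: "0 \<notin> path_image c" using c(3) by auto
  have c10: "c 1 = c 0" using c(2) by (simp add: pathfinish_def pathstart_def)
  obtain g where g: "path g" "pathfinish g - pathstart g = 2 * of_real pi * \<i> * winding_number c 0"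
      "\<And>t. t \<in> {0..1} \<Longrightarrow> c t = 0 + exp (g t)"
    using winding_number_as_continuous_log[OF c(1) c0] by blast
  define s where "s = (\<lambda>t. R * (\<sigma> * Im (g t)))"
  have s: "path s" "pathfinish s = pathstart s + \<sigma> * l"
  proof -
    show "path s" using g(1) unfolding s_def path_def by (intro continuous_intros)
    have "Im (pathfinish g - pathstart g) = 2 * pi" unfolding g(2) c(4) by simp
    then have "Im (g 1) = Im (g 0) + 2 * pi" by (simp add: pathfinish_def pathstart_def)
    moreover have "R * (2 * pi) = l" by (simp add: cyl_radius_def)
    then have "R * (\<sigma> * (x + 2 * pi)) = R * (\<sigma> * x) + \<sigma> * l" for x
      by (simp add: algebra_simps)
    ultimately show "pathfinish s = pathstart s + \<sigma> * l"
      by (simp add: s_def pathfinish_def pathstart_def)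
  qed
  have Ts: "T (s t) = T (R * (\<sigma> * Arg (c t)))" if "t \<in> {0..1}" for t
    using periodic_Arg_exp[of "\<lambda>x. T (R * (\<sigma> * x))"] periodic(2)[of T, OF T(2)] g(3)[OF that]
    by (simp add: s_def)
  have comp_path: "path (f \<circ> c)" if "continuous_on B f" for f :: "complex \<Rightarrow> complex"
    by (rule path_continuous_image[OF c(1) continuous_on_subset[OF that c(3)]])
  define q where "q = T \<circ> s"
  let ?K = "frame_components \<sigma> R G \<circ> c" and ?F = "field_over \<sigma> R G \<circ> c"
  let ?N = "\<lambda>t. (of_real \<sigma> * \<i>) * q t + 0 * cnj (q t)"
  have pTs: "path q" "pathfinish q = pathstart q" "0 \<notin> path_image q"
  proof -
    show "path q" unfolding q_def
      using T(1) by (intro path_continuous_image[OF s(1)]) (auto elim: continuous_on_subset)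
    show "pathfinish q = pathstart q"
      using s(2) periodic(1)[of T, OF T(2)] by (simp add: q_def pathfinish_def pathstart_def)
    show "0 \<notin> path_image q" using T_nonzero by (simp add: q_def path_image_def image_iff)
  qed
  have "winding_number ?K 0 = winding_number ?F 0"
    by (rule winding_number_eq_acute_angle)
      (use comp_path continuous_projected_field frame_components_acute cB c10 in
        \<open>auto simp: pathfinish_def pathstart_def simp del: Re_complex_of_real\<close>)
  also have "\<dots> = winding_number ?N 0"
  proof (rule winding_number_eq_acute_angle)
    show "path ?N" using pTs(1) unfolding path_def by (intro continuous_intros)
    show "pathfinish ?N = pathstart ?N"
      using pTs(2) by (simp add: pathfinish_def pathstart_def)
    show "pathfinish ?F = pathstart ?F" using c10 by (simp add: pathfinish_def pathstart_def)
    fix t :: real assume t: "t \<in> {0..1}"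
    show "0 < Re (cnj (?N t) * ?F t)"
      using field_over_acute[OF cB[OF t]] Ts[OF t] by (simp add: q_def)
  qed (rule comp_path[OF continuous_projected_field(2)])
  also have "\<dots> = winding_number q 0"
    by (rule winding_number_orientation_preserving_linear[OF pTs]) (use \<sigma> in \<open>auto simp: norm_mult\<close>)
  also have "\<dots> = winding_number (\<lambda>u. T (\<sigma> * l * u)) 0"
    unfolding q_def by (rule winding_number_periodic_comp[OF T(1) periodic(1)[of T, OF T(2)] _ s])
      (rule T_nonzero)
  finally have K: "winding_number ?K 0 = of_real \<sigma> * of_int (rotation_index l \<alpha>)"
    unfolding winding_number_tangent_oriented by simp
  \<comment> \<open>The frame makes the same single turn as \<open>c\<close> itself.\<close>
  let ?S = "\<lambda>t. of_real \<sigma> * \<i> * sgn (c t)" and ?C = "\<lambda>t. (of_real \<sigma> * \<i>) * c t + 0 * cnj (c t)"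
  have "continuous_on B (\<lambda>w. of_real \<sigma> * \<i> * sgn w)"
    by (intro continuous_intros) auto
  then have pS: "path ?S"
    using comp_path[of "\<lambda>w. of_real \<sigma> * \<i> * sgn w"] by (simp add: comp_def)
  have "winding_number ?S 0 = winding_number ?C 0"
  proof (rule winding_number_eq_acute_angle)
    show "path ?C" using c(1) unfolding path_def by (intro continuous_intros)
    fix t :: real assume t: "t \<in> {0..1}"
    have "cnj (?C t) * ?S t = of_real (\<sigma>\<^sup>2) * (cnj (c t) * sgn (c t))"
      by (simp add: complex_eq_iff power2_eq_square algebra_simps)
    also have "cnj (c t) * sgn (c t) = of_real (norm (c t))"
      using cB[OF t] complex_norm_square[of "c t"]
      by (simp add: sgn_eq field_simps power2_eq_square)
    finally have "cnj (?C t) * ?S t = of_real (norm (c t))"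
      using \<sigma> by auto
    then show "0 < Re (cnj (?C t) * ?S t)" using cB[OF t] by simp
  qed (use pS c10 in \<open>auto simp: pathfinish_def pathstart_def\<close>)
  also have "\<dots> = winding_number c 0"
    by (rule winding_number_orientation_preserving_linear[OF c(1,2) c0]) (use \<sigma> in \<open>auto simp: norm_mult\<close>)
  finally have S: "winding_number ?S 0 = 1" using c(4) by simp
  have "winding_number (projected_field \<sigma> R G \<circ> c) 0 = winding_number (\<lambda>t. ?S t * ?K t) 0"
    by (rule winding_number_cong) (simp add: projected_field_def)
  also have "\<dots> = winding_number ?S 0 + winding_number ?K 0"
  proof (rule winding_number_mult[OF pS comp_path[OF continuous_projected_field(3)]])
    show "0 \<notin> path_image ?S"
      using cB \<sigma> by (force simp: path_image_def sgn_zero_iff)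
    show "0 \<notin> path_image ?K"
      using cB frame_components_acute by (force simp: path_image_def)
  qed
  finally show ?thesis unfolding S K by (simp add: mult.commute)
qed

lemma poincare_index_at_pole:
  assumes i: "of_int i = (1 + of_real \<sigma> * of_int (rotation_index l \<alpha>) :: complex)"
  shows "has_poincare_index R (push_to_sphere l G) (vector [0, 0, \<sigma> * R]) i"
  unfolding has_poincare_index_def
proof (intro conjI allI impI)
  have "hemisphere \<sigma> R 0 = vector [0, 0, \<sigma> * R]"
    using R_pos by (simp add: hemisphere_def)
  moreover have "hemisphere \<sigma> R 0 \<in> hemisphere \<sigma> R ` ball 0 R"
    using R_pos by (intro imageI) simp
  ultimately show "\<exists>U \<psi>. oriented_chart R U \<psi> \<and> vector [0, 0, \<sigma> * R] \<in> \<psi> ` U"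
    using oriented_chart_hemisphere[OF R_pos \<sigma>] by metis
  fix U \<psi> z\<^sub>0
  assume chart: "oriented_chart R U \<psi> \<and> z\<^sub>0 \<in> U \<and> \<psi> z\<^sub>0 = vector [0, 0, \<sigma> * R]"
  show "has_planar_index (chart_field \<psi> (push_to_sphere l G)) z\<^sub>0 i"
  proof (rule has_planar_index_chart_field[OF R_pos \<sigma> _ _ _ r\<^sub>0(1)])
    show "oriented_chart R U \<psi>" "z\<^sub>0 \<in> U" "\<psi> z\<^sub>0 = vector [0, 0, \<sigma> * R]"
      using chart by auto
    fix P :: "real ^ 3"
    assume P: "P \<in> sphere 0 R" "\<sigma> * P $ 3 > 0" "equator_proj \<sigma> P \<in> B"
    show "push_to_sphere l G P \<bullet> P = 0 \<and>
        equator_proj \<sigma> (push_to_sphere l G P) = projected_field \<sigma> R G (equator_proj \<sigma> P)"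
      by (rule push_to_sphere_projected_field[OF l \<sigma> _ refl P(1,2)])
        (use P(3) r\<^sub>0(2) in \<open>auto simp: normal_map_def normal_vec_def \<alpha>(2) T(2)\<close>)
  next
    show "continuous_on B (projected_field \<sigma> R G)" by (rule continuous_projected_field(4))
  next
    fix w assume "w \<in> B"
    then show "projected_field \<sigma> R G w \<noteq> 0" by (rule projected_field_nonzero)
  next
    fix c :: "real \<Rightarrow> complex"
    assume "path c" "pathfinish c = pathstart c" "path_image c \<subseteq> B" "winding_number c 0 = 1"
    then show "winding_number (projected_field \<sigma> R G \<circ> c) 0 = of_int i"
      unfolding i by (rule projected_field_index)
  qed
qed

end

theorem theorem2:
  fixes \<alpha> :: "real \<Rightarrow> complex" and l :: real
  assumes "closed_arclength_curve l \<alpha>"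
    and "\<And>s. curvature \<alpha> s > 0"
  shows "has_poincare_index (cyl_radius l) (push_to_sphere l (normal_map \<alpha>)) (north_pole l)
           (1 + rotation_index l \<alpha>) \<and>
         has_poincare_index (cyl_radius l) (push_to_sphere l (normal_map \<alpha>)) (south_pole l)
           (1 - rotation_index l \<alpha>)"
proof -
  obtain r\<^sub>0 where "0 < r\<^sub>0" "r\<^sub>0 \<le> cyl_radius l" "\<And>s r. 0 < r \<Longrightarrow> r < r\<^sub>0 \<Longrightarrow>
      norm (\<alpha> s) < cyl_radius l * sqrt ((cyl_radius l)\<^sup>2 - r\<^sup>2) / r"
    using ex_radius_normal_dominates[OF assms(1)] by blast
  then have pole: "normal_map_near_pole l \<sigma> r\<^sub>0 \<alpha>" if "\<sigma> = 1 \<or> \<sigma> = - 1" for \<sigma>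
    using that assms(1) by unfold_locales
  show ?thesis
    using normal_map_near_pole.poincare_index_at_pole[OF pole, of 1 "1 + rotation_index l \<alpha>"]
      normal_map_near_pole.poincare_index_at_pole[OF pole, of "- 1" "1 - rotation_index l \<alpha>"]
    by (simp add: north_pole_def south_pole_def)
qed

end
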